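(* Let $L\ge2$ and fix an arbitrary ordered pair of words $(w,\widetilde w)\in W_L\times W_L$. There exist integer coefficients $\varphi_r(w,\widetilde w;z',z'')\in\mathbb Z$, where $r=1,2,3,4$ and $(z',z'')\in\operatorname{Odd}(w,\widetilde w)$, and $\psi_r(w,\widetilde w;z',z'')\in\mathbb Z$, where $r=1,2,3,4$ and $(z',z'')\in\operatorname{Even}(w,\widetilde w)$, such that for any indices $i,j,k,l\in\mathbb Z_{\ge1}$ and any $N\ge\max(i,j,k,l)$, the commutator $[e_{ij}(w;N),e_{kl}(\widetilde w;N)]$ in $U(\mathfrak{gl}(N,\mathbb C)^{\oplus L})$ can be written in any of the following four ways: $$\sum_{\operatorname{Odd}(w,\widetilde w)}\varphi_1(w,\widetilde w;z',z'')\,e_{kj}(z';N)e_{il}(z'';N)+\sum_{\operatorname{Even}(w,\widetilde w)}\psi_1(w,\widetilde w;z',z'')\,e_{ij}(z';N)e_{kl}(z'';N),$$ $$\sum_{\operatorname{Odd}(w,\widetilde w)}\varphi_2(w,\widetilde w;z',z'')\,e_{kj}(z';N)e_{il}(z'';N)+\sum_{\operatorname{Even}(w,\widetilde w)}\psi_2(w,\widetilde w;z',z'')\,e_{kl}(z';N)e_{ij}(z'';N),$$ $$\sum_{\operatorname{Odd}(w,\widetilde w)}\varphi_3(w,\widetilde w;z',z'')\,e_{il}(z';N)e_{kj}(z'';N)+\sum_{\operatorname{Even}(w,\widetilde w)}\psi_3(w,\widetilde w;z',z'')\,e_{ij}(z';N)e_{kl}(z'';N),$$ $$\sum_{\operatorname{Odd}(w,\widetilde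 w)}\varphi_4(w,\widetilde w;z',z'')\,e_{il}(z';N)e_{kj}(z'';N)+\sum_{\operatorname{Even}(w,\widetilde w)}\psi_4(w,\widetilde w;z',z'')\,e_{kl}(z';N)e_{ij}(z'';N),$$ where the sums are over $(z',z'')$ in the indicated sets; the coefficients do not depend on $N$ or on $i,j,k,l$. Moreover, the coefficients with these properties are defined uniquely.
   Context: $W_L$ is the set of nonempty words in the alphabet $[L]=\{1,\dots,L\}$, $\varnothing$ is the empty word, $\ell(\cdot)$ is the length. $E_{ij\mid\alpha}$ denotes the matrix unit $E_{ij}$ in the $\alpha$-th copy of $\mathfrak{gl}(N,\mathbb C)$ in the direct sum $\mathfrak{gl}(N,\mathbb C)^{\oplus L}$ of $L$ copies; $U(\cdot)$ is the universal enveloping algebra. For $w=w_1\dots w_n\in W_L$ and $1\le i,j\le N$, $$e_{ij}(w;N):=\sum_{a_1,\dots,a_{n-1}=1}^N E_{ia_1\mid w_1}E_{a_1a_2\mid w_2}\cdots E_{a_{n-1}j\mid w_n}\in U(\mathfrak{gl}(N,\mathbb C)^{\oplus L}),\qquad e_{ij}(\varnothing;N):=\delta_{ij}.$$ $\operatorname{Odd}(w,\widetilde w)$ is the set of ordered pairs $(z',z'')\in(W_L\cup\{\varnothing\})\times(W_L\cup\{\varnothing\})$, not both words being empty, such that $\ell(z')+\ell(z'')<\ell(w)+\ell(\widetilde w)$ and the difference $(\ell(w)+\ell(\widetilde w))-(\ell(z')+\ell(z''))$ is odd. $\operatorname{Even}(w,\widetilde w)$ is defined in the same way, with this difference being even.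 *)

theory Defs
  imports
    "HOL-Algebra.QuotRing"
    "HOL-Library.FuncSet"
    "HOL-Library.Poly_Mapping"
    "Jordan_Normal_Form.Matrix"
begin

text \<open>
  The bracket is a field of its own; the fields \<open>mult\<close> and \<open>one\<close> inherited from the ring
  record have no meaning for a Lie algebra (nor for a module) and are never used.
\<close>

record ('c, 'g) lie_algebra = "('c, 'g) module" +
  bracket :: "'g \<Rightarrow> 'g \<Rightarrow> 'g"

definition gl :: "nat \<Rightarrow> (complex, complex mat) lie_algebra" where
  "gl N = \<lparr>carrier = carrier_mat N N, monoid.mult = undefined, one = undefined,
     zero = 0\<^sub>m N N, add = (+), smult = (\<cdot>\<^sub>m), bracket = (\<lambda>A B. A * B - B * A)\<rparr>"

definition lie_power :: "nat \<Rightarrow> ('c, 'g) lie_algebra \<Rightarrow> ('c, nat \<Rightarrow> 'g) lie_algebra" where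
  "lie_power L g = \<lparr>carrier = {1..L} \<rightarrow>\<^sub>E carrier g, monoid.mult = undefined, one = undefined,
     zero = (\<lambda>\<alpha>\<in>{1..L}. \<zero>\<^bsub>g\<^esub>),
     add = (\<lambda>x y. \<lambda>\<alpha>\<in>{1..L}. x \<alpha> \<oplus>\<^bsub>g\<^esub> y \<alpha>),
     smult = (\<lambda>c x. \<lambda>\<alpha>\<in>{1..L}. c \<odot>\<^bsub>g\<^esub> x \<alpha>),
     bracket = (\<lambda>x y. \<lambda>\<alpha>\<in>{1..L}. bracket g (x \<alpha>) (y \<alpha>))\<rparr>"

text \<open>
  The free monoid, with concatenation written additively because the product of
  \<^typ>\<open>'m \<Rightarrow>\<^sub>0 'c\<close> is convolution with respect to the addition of \<open>'m\<close>. It is a separate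
  type so that no class instance is imposed on lists.
\<close>

datatype 'x free_monoid = Word (letters: "'x list")

instantiation free_monoid :: (type) monoid_add
begin

definition zero_free_monoid :: "'a free_monoid" where
  "0 = Word []"

definition plus_free_monoid :: "'a free_monoid \<Rightarrow> 'a free_monoid \<Rightarrow> 'a free_monoid" where
  "u + v = Word (letters u @ letters v)"

instance
  by standard (simp_all add: zero_free_monoid_def plus_free_monoid_def)

end

text \<open>The free associative unital algebra over \<open>\<complex>\<close> on the set \<open>X\<close>, i.e. the monoid algebra of
  the free monoid on \<open>X\<close>.\<close>

definition free_algebra :: "'x set \<Rightarrow> ('x free_monoid \<Rightarrow>\<^sub>0 complex) ring" where
  "free_algebra X = \<lparr>carrier = {p. \<forall>u \<in> Poly_Mapping.keys p. set (letters u) \<subseteq> X},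
     monoid.mult = (*), one = 1, zero = 0, add = (+)\<rparr>"

definition scalar :: "complex \<Rightarrow> 'x free_monoid \<Rightarrow>\<^sub>0 complex" where
  "scalar c = Poly_Mapping.single 0 c"

definition gen :: "'x \<Rightarrow> 'x free_monoid \<Rightarrow>\<^sub>0 complex" where
  "gen x = Poly_Mapping.single (Word [x]) 1"

text \<open>
  \<open>U(g)\<close> is the tensor algebra of \<open>g\<close> modulo \<open>x \<otimes> y - y \<otimes> x - [x, y]\<close>. The tensor algebra is
  itself the free algebra on the underlying set of \<open>g\<close> modulo the first two families of
  relations, which make \<^const>\<open>gen\<close> linear; the two quotients are taken in one step.
\<close>

definition uea_relations :: "(complex, 'g) lie_algebra \<Rightarrow> ('g free_monoid \<Rightarrow>\<^sub>0 complex) set" where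
  "uea_relations g =
     {gen (x \<oplus>\<^bsub>g\<^esub> y) - (gen x + gen y) | x y. x \<in> carrier g \<and> y \<in> carrier g}
   \<union> {gen (c \<odot>\<^bsub>g\<^esub> x) - scalar c * gen x | c x. x \<in> carrier g}
   \<union> {gen x * gen y - gen y * gen x - gen (bracket g x y) | x y. x \<in> carrier g \<and> y \<in> carrier g}"

definition uea_ideal :: "(complex, 'g) lie_algebra \<Rightarrow> ('g free_monoid \<Rightarrow>\<^sub>0 complex) set" where
  "uea_ideal g = genideal (free_algebra (carrier g)) (uea_relations g)"

definition uea :: "(complex, 'g) lie_algebra \<Rightarrow> ('g free_monoid \<Rightarrow>\<^sub>0 complex) set ring" where
  "uea g = free_algebra (carrier g) Quot uea_ideal g"

definition uea_of :: "(complex, 'g) lie_algebra \<Rightarrow> 'g \<Rightarrow> ('g free_monoid \<Rightarrow>\<^sub>0 complex) set" where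
  "uea_of g x = uea_ideal g +>\<^bsub>free_algebra (carrier g)\<^esub> gen x"

definition commutator :: "('a, 'm) ring_scheme \<Rightarrow> 'a \<Rightarrow> 'a \<Rightarrow> 'a" where
  "commutator R x y = x \<otimes>\<^bsub>R\<^esub> y \<ominus>\<^bsub>R\<^esub> y \<otimes>\<^bsub>R\<^esub> x"

type_synonym Ugl = "((nat \<Rightarrow> complex mat) free_monoid \<Rightarrow>\<^sub>0 complex) set"

definition U_gl :: "nat \<Rightarrow> nat \<Rightarrow> Ugl ring" where
  "U_gl L N = uea (lie_power L (gl N))"

text \<open>Matrix units are indexed from 1, whereas the entries of \<^typ>\<open>complex mat\<close> are indexed
  from 0.\<close>

definition mat_unit :: "nat \<Rightarrow> nat \<Rightarrow> nat \<Rightarrow> complex mat" where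
  "mat_unit N i j = mat N N (\<lambda>(r, c). if Suc r = i \<and> Suc c = j then 1 else 0)"

definition E_gen :: "nat \<Rightarrow> nat \<Rightarrow> nat \<Rightarrow> nat \<Rightarrow> nat \<Rightarrow> Ugl" where
  "E_gen L N i j \<alpha> = uea_of (lie_power L (gl N))
     (\<lambda>\<beta>\<in>{1..L}. if \<beta> = \<alpha> then mat_unit N i j else 0\<^sub>m N N)"

definition prod_list_in :: "('a, 'm) ring_scheme \<Rightarrow> 'a list \<Rightarrow> 'a" where
  "prod_list_in R xs = foldr (\<lambda>x y. x \<otimes>\<^bsub>R\<^esub> y) xs \<one>\<^bsub>R\<^esub>"

text \<open>This is \<open>e\<^sub>i\<^sub>j(w; N)\<close>. For nonempty \<open>w\<close> the list \<open>as\<close> is \<open>[a\<^sub>1, \<dots>, a\<^sub>n\<^sub>-\<^sub>1]\<close>, so that \<open>(i # as) ! m\<close> and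
  \<open>(as @ [j]) ! m\<close> are the row and the column index of the factor belonging to \<open>w ! m\<close>.\<close>

definition e_word :: "nat \<Rightarrow> nat \<Rightarrow> nat \<Rightarrow> nat \<Rightarrow> nat list \<Rightarrow> Ugl" where
  "e_word L N i j w =
     (if w = [] then (if i = j then \<one>\<^bsub>U_gl L N\<^esub> else \<zero>\<^bsub>U_gl L N\<^esub>)
      else (\<Oplus>\<^bsub>U_gl L N\<^esub> as \<in> {as. length as = length w - 1 \<and> set as \<subseteq> {1..N}}.
        prod_list_in (U_gl L N)
          (map (\<lambda>m. E_gen L N ((i # as) ! m) ((as @ [j]) ! m) (w ! m)) [0..<length w])))"

definition words :: "nat \<Rightarrow> nat list set" where
  "words L = {w. w \<noteq> [] \<and> set w \<subseteq> {1..L}}"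

definition Odd :: "nat \<Rightarrow> nat list \<Rightarrow> nat list \<Rightarrow> (nat list \<times> nat list) set" where
  "Odd L w w' = {(z', z''). z' \<in> words L \<union> {[]} \<and> z'' \<in> words L \<union> {[]}
     \<and> \<not> (z' = [] \<and> z'' = [])
     \<and> length z' + length z'' < length w + length w'
     \<and> odd ((length w + length w') - (length z' + length z''))}"

definition Even :: "nat \<Rightarrow> nat list \<Rightarrow> nat list \<Rightarrow> (nat list \<times> nat list) set" where
  "Even L w w' = {(z', z''). z' \<in> words L \<union> {[]} \<and> z'' \<in> words L \<union> {[]}
     \<and> \<not> (z' = [] \<and> z'' = [])
     \<and> length z' + length z'' < length w + length w'
     \<and> even ((length w + length w') - (length z' + length z''))}"

definition coeff_sum :: "nat \<Rightarrow> nat \<Rightarrow> (nat list \<times> nat list) set \<Rightarrow>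
    (nat list \<times> nat list \<Rightarrow> int) \<Rightarrow> nat \<Rightarrow> nat \<Rightarrow> nat \<Rightarrow> nat \<Rightarrow> Ugl" where
  "coeff_sum L N S c i j k l =
     (\<Oplus>\<^bsub>U_gl L N\<^esub> z \<in> S.
        [c z] \<cdot>\<^bsub>U_gl L N\<^esub> (e_word L N i j (fst z) \<otimes>\<^bsub>U_gl L N\<^esub> e_word L N k l (snd z)))"

text \<open>\<open>\<phi> r\<close> and \<open>\<psi> r\<close> are the coefficients of the \<open>r\<close>-th expansion. Only \<open>r \<in> {1..4}\<close> and the
  values of \<open>\<phi> r\<close> on \<^const>\<open>Odd\<close> and of \<open>\<psi> r\<close> on \<^const>\<open>Even\<close> matter.\<close>

definition expands_commutators :: "nat \<Rightarrow> nat list \<Rightarrow> nat list \<Rightarrow>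
    (nat \<Rightarrow> nat list \<times> nat list \<Rightarrow> int) \<Rightarrow> (nat \<Rightarrow> nat list \<times> nat list \<Rightarrow> int) \<Rightarrow> bool" where
  "expands_commutators L w w' \<phi> \<psi> \<longleftrightarrow>
     (\<forall>i j k l N. 1 \<le> i \<and> 1 \<le> j \<and> 1 \<le> k \<and> 1 \<le> l \<and> i \<le> N \<and> j \<le> N \<and> k \<le> N \<and> l \<le> N \<longrightarrow>
       (let U = U_gl L N;
            comm = commutator U (e_word L N i j w) (e_word L N k l w');
            sum_Odd = coeff_sum L N (Odd L w w');
            sum_Even = coeff_sum L N (Even L w w')
        in comm = sum_Odd (\<phi> 1) k j i l \<oplus>\<^bsub>U\<^esub> sum_Even (\<psi> 1) i j k l
         \<and> comm = sum_Odd (\<phi> 2) k j i l \<oplus>\<^bsub>U\<^esub> sum_Even (\<psi> 2) k l i j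
         \<and> comm = sum_Odd (\<phi> 3) i l k j \<oplus>\<^bsub>U\<^esub> sum_Even (\<psi> 3) i j k l
         \<and> comm = sum_Odd (\<phi> 4) i l k j \<oplus>\<^bsub>U\<^esub> sum_Even (\<psi> 4) k l i j))"

end

theory Submission
  imports Defs
begin

text \<open>
  All computations take place with representatives in the free algebra, modulo the ideal that
  defines the enveloping algebra.

  For existence, expand \<open>e\<^sub>i\<^sub>j(w) e\<^sub>k\<^sub>l(w')\<close> into products of generators. Each product is traversed
  by two chains of indices, one from \<open>i\<close> to \<open>j\<close> and one from \<open>k\<close> to \<open>l\<close>. More generally the
  factors of two chains may be interleaved in any way, which keeps the order within each chain;
  such an arrangement is a shuffle of two words (\<open>shuffle\<close>). Exchanging two neighbouring factors
  of different chains costs a commutator \<open>[E\<^sub>a\<^sub>b, E\<^sub>c\<^sub>d] = \<delta>\<^sub>b\<^sub>c E\<^sub>a\<^sub>d - \<delta>\<^sub>d\<^sub>a E\<^sub>c\<^sub>b\<close>. In both terms one factor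
  is lost and the chains reconnect crosswise: the first now continues along the tail of the second
  and conversely (\<open>shuffle_exchange\<close>). So the result is again a difference of two shuffles, with
  the end points \<open>j\<close> and \<open>l\<close> interchanged. A chain never closes up, because only factors of
  different chains are exchanged; hence no trace occurs, and with it no factor \<open>N\<close>. The parity of
  the number of lost letters tells which chain ends in \<open>j\<close>. By induction on the length, a shuffle
  can be sorted so that either chain comes first, and the order can be chosen separately for the
  terms with uncrossed and with crossed ends; this gives the four forms (\<open>expandable_shuffle\<close>).
  The two products in the commutator are shuffles of the same two chains, so their difference only
  involves the shorter terms (\<open>expandable_commutator\<close>).

  For uniqueness, let the Lie algebra act on a tensor product of copies of \<open>\<complex>\<^sup>N\<close>, one for each
  letter of a word \<open>z\<close>, the \<open>\<alpha>\<close>-th summand acting on the positions whose letter is \<open>\<alpha>\<close>. A product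
  of \<open>m\<close> generators changes at most \<open>m\<close> positions of a basis tensor. Given a pair of words with
  \<open>n\<close> letters in total, take for \<open>z\<close> their concatenation and two basis tensors that differ at every
  position, so that the required changes of index form two disjoint directed paths, one for each
  word of the pair. Then the matrix coefficient between these tensors is \<open>1\<close> on the product
  belonging to this pair and \<open>0\<close> on the product belonging to any other pair with at most \<open>n\<close>
  letters, for the index values at which the paths begin and end (\<open>detect_first\<close>,
  \<open>detect_start\<close>). Applied to a pair of maximal length among the nonzero coefficients of a
  vanishing combination, this is a contradiction (\<open>expansion_zero_imp_coeffs_zero\<close>).
\<close>

section \<open>The free algebra and the universal enveloping algebra\<close>

lemma free_algebra_simps [simp]:
  "monoid.mult (free_algebra X) = (*)" "monoid.one (free_algebra X) = 1" "ring.zero (free_algebra X) = 0" "ring.add (free_algebra X) = (+)"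
  by (simp_all add: free_algebra_def)

lemma one_carrier [simp]: "1 \<in> carrier (free_algebra X)"
  by (auto simp: free_algebra_def zero_free_monoid_def)

lemma zero_carrier [simp]: "0 \<in> carrier (free_algebra X)"
  by (auto simp: free_algebra_def)

lemma scalar_carrier [simp]: "scalar c \<in> carrier (free_algebra X)"
  by (auto simp: free_algebra_def scalar_def zero_free_monoid_def)

lemma gen_carrier [simp]: "x \<in> X \<Longrightarrow> gen x \<in> carrier (free_algebra X)"
  by (auto simp: free_algebra_def gen_def)

lemma add_carrier [intro]:
  "p \<in> carrier (free_algebra X) \<Longrightarrow> q \<in> carrier (free_algebra X) \<Longrightarrow> p + q \<in> carrier (free_algebra X)"
  using Poly_Mapping.keys_add[of p q] by (auto simp: free_algebra_def)

lemma uminus_carrier [intro]: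
  "p \<in> carrier (free_algebra X) \<Longrightarrow> - p \<in> carrier (free_algebra X)"
  by (auto simp: free_algebra_def)

lemma minus_carrier [intro]:
  "p \<in> carrier (free_algebra X) \<Longrightarrow> q \<in> carrier (free_algebra X) \<Longrightarrow> p - q \<in> carrier (free_algebra X)"
  using add_carrier[of p X "- q"] by auto

lemma mult_carrier [intro]:
  assumes "p \<in> carrier (free_algebra X)" "q \<in> carrier (free_algebra X)"
  shows "p * q \<in> carrier (free_algebra X)"
  using Poly_Mapping.keys_mult[of p q] assms by (fastforce simp: free_algebra_def plus_free_monoid_def)

lemma sum_carrier [intro]:
  "(\<And>a. a \<in> A \<Longrightarrow> p a \<in> carrier (free_algebra X)) \<Longrightarrow> sum p A \<in> carrier (free_algebra X)"
  by (induction A rule: infinite_finite_induct) auto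

lemma prod_list_carrier [intro]:
  "(\<And>p. p \<in> set ps \<Longrightarrow> p \<in> carrier (free_algebra X)) \<Longrightarrow> prod_list ps \<in> carrier (free_algebra X)"
  by (induction ps) auto

lemma of_int_carrier [simp]: "of_int c \<in> carrier (free_algebra X)"
proof -
  have "of_int c = scalar (of_int c :: complex)" by (simp add: scalar_def)
  then show ?thesis by (metis scalar_carrier)
qed

lemma ring_free_algebra: "ring (free_algebra X)"
proof (intro ringI abelian_groupI monoidI)
  fix p assume "p \<in> carrier (free_algebra X)"
  then show "\<exists>q\<in>carrier (free_algebra X). q \<oplus>\<^bsub>free_algebra X\<^esub> p = \<zero>\<^bsub>free_algebra X\<^esub>"
    by (intro bexI[of _ "- p"]) auto
qed (auto simp: algebra_simps)

lemma a_inv_free_algebra: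
  assumes "p \<in> carrier (free_algebra X)"
  shows "\<ominus>\<^bsub>free_algebra X\<^esub> p = - p"
proof -
  interpret ring "free_algebra X" by (rule ring_free_algebra)
  show ?thesis using minus_equality[of "- p" p] assms by auto
qed

lemma int_multiple_free_algebra:
  assumes "p \<in> carrier (free_algebra X)"
  shows "[c] \<cdot>\<^bsub>free_algebra X\<^esub> p = of_int c * p"
proof -
  interpret ring "free_algebra X" by (rule ring_free_algebra)
  have nat: "[n] \<cdot>\<^bsub>free_algebra X\<^esub> p = of_nat n * p" for n :: nat
    by (induction n) (auto simp: algebra_simps assms)
  show ?thesis
  proof (cases "c \<ge> 0")
    case True
    then show ?thesis by (simp add: add_pow_int_ge nat)
  next
    case False
    define n where "n = nat (- c)"
    have "of_nat n * p \<in> carrier (free_algebra X)"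
      using mult_carrier[OF of_int_carrier[of "int n"] assms] by simp
    moreover have "c = - int n" using False by (simp add: n_def)
    ultimately show ?thesis using False
      by (simp add: add_pow_int_lt nat a_inv_free_algebra flip: n_def)
  qed
qed

text \<open>
  Closure under the operations puts the defining relations into the free algebra on the carrier,
  where they generate an ideal.
\<close>

locale closed_lie_algebra =
  fixes g :: "(complex, 'g) lie_algebra"
  assumes add_closed: "x \<in> carrier g \<Longrightarrow> y \<in> carrier g \<Longrightarrow> x \<oplus>\<^bsub>g\<^esub> y \<in> carrier g"
    and smult_closed: "x \<in> carrier g \<Longrightarrow> c \<odot>\<^bsub>g\<^esub> x \<in> carrier g"
    and bracket_closed: "x \<in> carrier g \<Longrightarrow> y \<in> carrier g \<Longrightarrow> bracket g x y \<in> carrier g"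
begin

abbreviation F where "F \<equiv> free_algebra (carrier g)"

definition cls :: "('g free_monoid \<Rightarrow>\<^sub>0 complex) \<Rightarrow> ('g free_monoid \<Rightarrow>\<^sub>0 complex) set" where
  "cls p = uea_ideal g +>\<^bsub>F\<^esub> p"

lemma uea_relations_carrier: "uea_relations g \<subseteq> carrier F"
  by (auto simp: uea_relations_def add_closed smult_closed bracket_closed
      intro!: minus_carrier add_carrier mult_carrier)

lemma ideal_uea_ideal: "ideal (uea_ideal g) F"
  unfolding uea_ideal_def by (rule ring.genideal_ideal[OF ring_free_algebra uea_relations_carrier])

lemma ring_hom_cls: "ring_hom_ring F (uea g) cls"
proof -
  have "cls = (+>\<^bsub>F\<^esub>) (uea_ideal g)" by (simp add: cls_def fun_eq_iff)
  then show ?thesis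
    using ideal.rcos_ring_hom_ring[OF ideal_uea_ideal] by (simp add: uea_def)
qed

lemma relation_ideal: "p \<in> uea_relations g \<Longrightarrow> p \<in> uea_ideal g"
  using ring.genideal_self[OF ring_free_algebra uea_relations_carrier] unfolding uea_ideal_def by blast

lemma ideal_zero: "0 \<in> uea_ideal g"
  using additive_subgroup.zero_closed[OF ideal.axioms(1)[OF ideal_uea_ideal]] by simp

lemma ideal_add: "p \<in> uea_ideal g \<Longrightarrow> q \<in> uea_ideal g \<Longrightarrow> p + q \<in> uea_ideal g"
  using additive_subgroup.a_closed[OF ideal.axioms(1)[OF ideal_uea_ideal], of p q] by simp

lemma ideal_mult_left: "p \<in> uea_ideal g \<Longrightarrow> q \<in> carrier F \<Longrightarrow> q * p \<in> uea_ideal g"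
  using ideal.I_l_closed[OF ideal_uea_ideal, of p q] by simp

lemma ideal_mult_right: "p \<in> uea_ideal g \<Longrightarrow> q \<in> carrier F \<Longrightarrow> p * q \<in> uea_ideal g"
  using ideal.I_r_closed[OF ideal_uea_ideal, of p q] by simp

lemma ideal_uminus: "p \<in> uea_ideal g \<Longrightarrow> - p \<in> uea_ideal g"
  using ideal_mult_left[of p "- 1"] uminus_carrier[OF one_carrier, of "carrier g"] by simp

lemma ideal_minus: "p \<in> uea_ideal g \<Longrightarrow> q \<in> uea_ideal g \<Longrightarrow> p - q \<in> uea_ideal g"
  using ideal_add[of p "- q"] ideal_uminus[of q] by simp

lemma ideal_sum: "(\<And>a. a \<in> A \<Longrightarrow> p a \<in> uea_ideal g) \<Longrightarrow> sum p A \<in> uea_ideal g"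
  by (induction A rule: infinite_finite_induct) (auto intro: ideal_add simp: ideal_zero)

lemma cls_eq_iff:
  assumes "p \<in> carrier F" "q \<in> carrier F"
  shows "cls p = cls q \<longleftrightarrow> p - q \<in> uea_ideal g"
proof -
  have "p \<ominus>\<^bsub>F\<^esub> q = p - q" using assms(2) by (simp add: a_minus_def a_inv_free_algebra)
  then show ?thesis unfolding cls_def
    using ring.quotient_eq_iff_same_a_r_cos[OF ring_free_algebra ideal_uea_ideal assms] by simp
qed

lemma cls_one: "\<one>\<^bsub>uea g\<^esub> = cls 1"
  using ring_hom_one[OF ring_hom_ring.homh[OF ring_hom_cls]] by simp

lemma cls_zero: "\<zero>\<^bsub>uea g\<^esub> = cls 0"
proof -
  interpret ring_hom_ring F "uea g" cls by (rule ring_hom_cls)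
  show ?thesis using hom_zero by simp
qed

lemma cls_mult: "p \<in> carrier F \<Longrightarrow> q \<in> carrier F \<Longrightarrow> cls p \<otimes>\<^bsub>uea g\<^esub> cls q = cls (p * q)"
  using ring_hom_mult[OF ring_hom_ring.homh[OF ring_hom_cls], of p q] by simp

lemma cls_add: "p \<in> carrier F \<Longrightarrow> q \<in> carrier F \<Longrightarrow> cls p \<oplus>\<^bsub>uea g\<^esub> cls q = cls (p + q)"
  using ring_hom_add[OF ring_hom_ring.homh[OF ring_hom_cls], of p q] by simp

lemma cls_minus: 
  assumes "p \<in> carrier F" "q \<in> carrier F" shows "cls p \<ominus>\<^bsub>uea g\<^esub> cls q = cls (p - q)"
proof -
  interpret ring_hom_ring F "uea g" cls by (rule ring_hom_cls)
  have "\<ominus>\<^bsub>uea g\<^esub> cls q = cls (- q)"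
    using hom_a_inv[of q] assms by (simp add: a_inv_free_algebra)
  then show ?thesis using assms cls_add[of p "- q"] by (auto simp: a_minus_def)
qed

lemma cls_sum:
  assumes "\<And>a. a \<in> A \<Longrightarrow> p a \<in> carrier F"
  shows "(\<Oplus>\<^bsub>uea g\<^esub> a \<in> A. cls (p a)) = cls (\<Sum>a\<in>A. p a)"
proof -
  interpret ring_hom_ring F "uea g" cls by (rule ring_hom_cls)
  show ?thesis
    using assms
  proof (induction A rule: infinite_finite_induct)
    case (insert a A)
    then have "p a \<in> carrier F" "(\<Sum>a\<in>A. p a) \<in> carrier F" by auto
    with insert show ?case by (simp add: Pi_def cls_add)
  qed (simp_all add: cls_zero)
qed

lemma cls_prod_list:
  assumes "\<And>p. p \<in> set ps \<Longrightarrow> p \<in> carrier F"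
  shows "prod_list_in (uea g) (map cls ps) = cls (prod_list ps)"
  using assms by (induction ps) (auto simp: prod_list_in_def cls_one cls_mult prod_list_carrier)

lemma cls_int_multiple:
  assumes "p \<in> carrier F"
  shows "[c] \<cdot>\<^bsub>uea g\<^esub> cls p = cls (of_int c * p)"
proof -
  interpret ring_hom_ring F "uea g" cls by (rule ring_hom_cls)
  have "cls ([c] \<cdot>\<^bsub>F\<^esub> p) = [c] \<cdot>\<^bsub>uea g\<^esub> cls p"
    using group_hom.hom_int_pow[OF a_group_hom] assms by (simp add: add_pow_def)
  then show ?thesis using assms by (simp add: int_multiple_free_algebra)
qed

text \<open>
  Equality in the enveloping algebra, expressed for representatives. It turns every identity
  between cosets into a computation in a ring of the type class hierarchy.
\<close>

definition cong :: "('g free_monoid \<Rightarrow>\<^sub>0 complex) \<Rightarrow> ('g free_monoid \<Rightarrow>\<^sub>0 complex) \<Rightarrow> bool" where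
  "cong p q \<longleftrightarrow> p - q \<in> uea_ideal g"

lemma cong_refl [simp]: "cong p p"
  by (simp add: cong_def ideal_zero)

lemma cong_sym: "cong p q \<Longrightarrow> cong q p"
  using ideal_uminus[of "p - q"] by (simp only: cong_def minus_diff_eq)

lemma cong_trans [trans]: "cong p q \<Longrightarrow> cong q r \<Longrightarrow> cong p r"
  using ideal_add[of "p - q" "q - r"] by (simp only: cong_def diff_add_cancel add_diff_eq)

lemma cong_add:
  assumes "cong p q" "cong p' q'"
  shows "cong (p + p') (q + q')"
proof -
  have "(p + p') - (q + q') = (p - q) + (p' - q')" by (rule add_diff_add)
  then show ?thesis using ideal_add[OF assms[unfolded cong_def]] by (simp only: cong_def)
qed

lemma cong_diff:
  assumes "cong p q" "cong p' q'"
  shows "cong (p - p') (q - q')"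
proof -
  have "(p - p') - (q - q') = (p - q) - (p' - q')" by (simp only: algebra_simps)
  then show ?thesis using ideal_minus[OF assms[unfolded cong_def]] by (simp only: cong_def)
qed

lemma cong_mult_left: "cong p q \<Longrightarrow> r \<in> carrier F \<Longrightarrow> cong (r * p) (r * q)"
  using ideal_mult_left[of "p - q" r] by (simp only: cong_def right_diff_distrib left_diff_distrib)

lemma cong_mult_right: "cong p q \<Longrightarrow> r \<in> carrier F \<Longrightarrow> cong (p * r) (q * r)"
  using ideal_mult_right[of "p - q" r] by (simp only: cong_def right_diff_distrib left_diff_distrib)

lemma cong_sum: "(\<And>a. a \<in> A \<Longrightarrow> cong (p a) (q a)) \<Longrightarrow> cong (sum p A) (sum q A)"
  using ideal_sum[of A "\<lambda>a. p a - q a"] by (simp only: cong_def sum_subtractf)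

lemma cong_gen_add:
  "x \<in> carrier g \<Longrightarrow> y \<in> carrier g \<Longrightarrow> cong (gen (x \<oplus>\<^bsub>g\<^esub> y)) (gen x + gen y)"
  unfolding cong_def by (rule relation_ideal) (unfold uea_relations_def, blast)

lemma cong_gen_smult: "x \<in> carrier g \<Longrightarrow> cong (gen (c \<odot>\<^bsub>g\<^esub> x)) (scalar c * gen x)"
  unfolding cong_def by (rule relation_ideal) (unfold uea_relations_def, blast)

lemma cong_gen_bracket:
  "x \<in> carrier g \<Longrightarrow> y \<in> carrier g \<Longrightarrow> cong (gen x * gen y - gen y * gen x) (gen (bracket g x y))"
  unfolding cong_def by (rule relation_ideal) (unfold uea_relations_def, blast)

lemma cls_eq_iff_cong: "p \<in> carrier F \<Longrightarrow> q \<in> carrier F \<Longrightarrow> cls p = cls q \<longleftrightarrow> cong p q"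
  by (simp add: cls_eq_iff cong_def)

end

section \<open>Words of matrix units\<close>

text \<open>
  Representatives of the elements of the enveloping algebra of the direct sum of \<open>L\<close> copies of
  \<open>gl(N)\<close>.
\<close>

type_synonym gl_element = "(nat \<Rightarrow> complex mat) free_monoid \<Rightarrow>\<^sub>0 complex"

lemma carrier_lie_power_gl: "carrier (lie_power L (gl N)) = {1..L} \<rightarrow>\<^sub>E carrier_mat N N"
  by (simp add: lie_power_def gl_def)

lemma lie_power_gl_simps:
  "x \<oplus>\<^bsub>lie_power L (gl N)\<^esub> y = (\<lambda>\<alpha>\<in>{1..L}. x \<alpha> + y \<alpha>)"
  "c \<odot>\<^bsub>lie_power L (gl N)\<^esub> x = (\<lambda>\<alpha>\<in>{1..L}. c \<cdot>\<^sub>m x \<alpha>)"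
  "bracket (lie_power L (gl N)) x y = (\<lambda>\<alpha>\<in>{1..L}. x \<alpha> * y \<alpha> - y \<alpha> * x \<alpha>)"
  by (simp_all add: lie_power_def gl_def)

interpretation UG: closed_lie_algebra "lie_power L (gl N)" for L N
  by standard
    (auto simp: carrier_lie_power_gl lie_power_gl_simps PiE_iff
      intro!: add_carrier_mat minus_carrier_mat mult_carrier_mat[of _ N N _ N])

definition gl_unit :: "nat \<Rightarrow> nat \<Rightarrow> nat \<Rightarrow> nat \<Rightarrow> nat \<Rightarrow> nat \<Rightarrow> complex mat" where
  "gl_unit L N i j \<alpha> = (\<lambda>\<beta>\<in>{1..L}. if \<beta> = \<alpha> then mat_unit N i j else 0\<^sub>m N N)"

lemma mat_unit_carrier [simp]: "mat_unit N i j \<in> carrier_mat N N"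
  by (simp add: mat_unit_def)

lemma gl_unit_carrier [simp]: "gl_unit L N i j \<alpha> \<in> carrier (lie_power L (gl N))"
  by (simp add: gl_unit_def carrier_lie_power_gl)

lemma mat_unit_mult:
  assumes "j \<in> {1..N}"
  shows "mat_unit N i j * mat_unit N k l = (if j = k then mat_unit N i l else 0\<^sub>m N N)"
proof (rule eq_matI)
  fix r c assume "r < dim_row (if j = k then mat_unit N i l else 0\<^sub>m N N)"
    and "c < dim_col (if j = k then mat_unit N i l else 0\<^sub>m N N)"
  then have rc: "r < N" "c < N" by (simp_all add: mat_unit_def split: if_splits)
  then have "(mat_unit N i j * mat_unit N k l) $$ (r, c)
      = (\<Sum>m = 0..<N. (if Suc r = i \<and> Suc m = j then 1 else 0) * (if Suc m = k \<and> Suc c = l then 1 else 0))"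
    by (simp add: mat_unit_def scalar_prod_def)
  also have "\<dots> = (\<Sum>m = 0..<N. if m = j - 1 then (if Suc r = i \<and> j = k \<and> Suc c = l then 1 else 0) else 0)"
    using assms by (intro sum.cong) auto
  also have "\<dots> = (if j = k then mat_unit N i l else 0\<^sub>m N N) $$ (r, c)"
    using assms rc by (subst sum.delta) (auto simp: mat_unit_def)
  finally show "(mat_unit N i j * mat_unit N k l) $$ (r, c) = \<dots>" .
qed (simp_all add: mat_unit_def)

text \<open>
  Both coefficients may vanish. Writing the bracket as a sum with scalar coefficients lets the
  linearity relations of the enveloping algebra apply without a case distinction.
\<close>

lemma bracket_gl_unit:
  assumes "i \<in> {1..N}" "j \<in> {1..N}" "k \<in> {1..N}" "l \<in> {1..N}"
    and g: "g = lie_power L (gl N)"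
  shows "bracket g (gl_unit L N i j \<alpha>) (gl_unit L N k l \<beta>) =
    (of_bool (\<alpha> = \<beta> \<and> j = k) \<odot>\<^bsub>g\<^esub> gl_unit L N i l \<alpha>) \<oplus>\<^bsub>g\<^esub> (- of_bool (\<alpha> = \<beta> \<and> l = i) \<odot>\<^bsub>g\<^esub> gl_unit L N k j \<alpha>)"
  unfolding g lie_power_gl_simps
proof (intro restrict_ext)
  fix \<gamma> assume \<gamma>: "\<gamma> \<in> {1..L}"
  have mat_simps: "A - A = 0\<^sub>m N N" "A + 0\<^sub>m N N = A" "0\<^sub>m N N + A = A" "0 \<cdot>\<^sub>m A = 0\<^sub>m N N" 
     "1 \<cdot>\<^sub>m A = A" "A * 0\<^sub>m N N = 0\<^sub>m N N" "0\<^sub>m N N * A = 0\<^sub>m N N" "A - 0\<^sub>m N N = A" "0\<^sub>m N N - A = (- 1) \<cdot>\<^sub>m A"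
     "B \<in> carrier_mat N N \<Longrightarrow> A - B = A + (- 1) \<cdot>\<^sub>m B"
    if "A \<in> carrier_mat N N" for A B :: "complex mat"
    using that by auto
  show "gl_unit L N i j \<alpha> \<gamma> * gl_unit L N k l \<beta> \<gamma> - gl_unit L N k l \<beta> \<gamma> * gl_unit L N i j \<alpha> \<gamma> =
         (\<lambda>\<gamma>\<in>{1..L}. of_bool (\<alpha> = \<beta> \<and> j = k) \<cdot>\<^sub>m gl_unit L N i l \<alpha> \<gamma>) \<gamma>
         + (\<lambda>\<gamma>\<in>{1..L}. - of_bool (\<alpha> = \<beta> \<and> l = i) \<cdot>\<^sub>m gl_unit L N k j \<alpha> \<gamma>) \<gamma>"
    using assms \<gamma> by (simp add: gl_unit_def mat_unit_mult mat_simps)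
qed

definition unit_gen :: "nat \<Rightarrow> nat \<Rightarrow> nat \<Rightarrow> nat \<Rightarrow> nat \<Rightarrow> gl_element" where
  "unit_gen L N i j \<alpha> = gen (gl_unit L N i j \<alpha>)"

lemma unit_gen_carrier [simp]: "unit_gen L N i j \<alpha> \<in> carrier (UG.F L N)"
  by (simp add: unit_gen_def)

lemma unit_gen_commutator:
  assumes "i \<in> {1..N}" "j \<in> {1..N}" "k \<in> {1..N}" "l \<in> {1..N}"
  shows "UG.cong L N (unit_gen L N i j \<alpha> * unit_gen L N k l \<beta> - unit_gen L N k l \<beta> * unit_gen L N i j \<alpha>)
    (of_bool (\<alpha> = \<beta> \<and> j = k) * unit_gen L N i l \<alpha> - of_bool (\<alpha> = \<beta> \<and> l = i) * unit_gen L N k j \<alpha>)"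
proof -
  let ?g = "lie_power L (gl N)"
  let ?c = "of_bool (\<alpha> = \<beta> \<and> j = k) :: complex" and ?d = "- of_bool (\<alpha> = \<beta> \<and> l = i) :: complex"
  let ?x = "gl_unit L N i l \<alpha>" and ?y = "gl_unit L N k j \<alpha>"
  have "UG.cong L N (unit_gen L N i j \<alpha> * unit_gen L N k l \<beta> - unit_gen L N k l \<beta> * unit_gen L N i j \<alpha>)
    (gen (bracket ?g (gl_unit L N i j \<alpha>) (gl_unit L N k l \<beta>)))"
    unfolding unit_gen_def by (rule UG.cong_gen_bracket) simp_all
  also have "bracket ?g (gl_unit L N i j \<alpha>) (gl_unit L N k l \<beta>) = (?c \<odot>\<^bsub>?g\<^esub> ?x) \<oplus>\<^bsub>?g\<^esub> (?d \<odot>\<^bsub>?g\<^esub> ?y)"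
    by (rule bracket_gl_unit[OF assms refl])
  also have "UG.cong L N (gen \<dots>) (gen (?c \<odot>\<^bsub>?g\<^esub> ?x) + gen (?d \<odot>\<^bsub>?g\<^esub> ?y))"
    by (rule UG.cong_gen_add) (simp_all add: UG.smult_closed)
  also have "UG.cong L N \<dots> (scalar ?c * gen ?x + scalar ?d * gen ?y)"
    by (intro UG.cong_add UG.cong_gen_smult gl_unit_carrier)
  also have "scalar ?c * gen ?x + scalar ?d * gen ?y
      = of_bool (\<alpha> = \<beta> \<and> j = k) * unit_gen L N i l \<alpha> - of_bool (\<alpha> = \<beta> \<and> l = i) * unit_gen L N k j \<alpha>"
    by (simp add: scalar_def unit_gen_def single_uminus)
  finally show ?thesis .
qed

text \<open>
  A representative of \<open>e\<^sub>i\<^sub>j(w; N)\<close>, defined by splitting off the first factor and summing over the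
  index behind it. The recursion replaces the sum over all lists of intermediate indices.
\<close>

fun matrix_word :: "nat \<Rightarrow> nat \<Rightarrow> nat \<Rightarrow> nat \<Rightarrow> nat list \<Rightarrow> gl_element" where
  "matrix_word L N i j [] = of_bool (i = j)"
| "matrix_word L N i j (\<alpha> # w) = (\<Sum>a=1..N. unit_gen L N i a \<alpha> * matrix_word L N a j w)"

lemma of_bool_carrier [simp]: "of_bool P \<in> carrier (free_algebra X)"
  by (cases P) auto

lemma matrix_word_carrier [simp]: "matrix_word L N i j w \<in> carrier (UG.F L N)"
  by (induction w arbitrary: i) (auto intro!: sum_carrier mult_carrier)

lemma sum_lists_Suc:
  "(\<Sum>as | length as = Suc n \<and> set as \<subseteq> A. f as) = (\<Sum>a\<in>A. \<Sum>as | length as = n \<and> set as \<subseteq> A. f (a # as))"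
  if "finite A"
proof -
  have "{as. length as = Suc n \<and> set as \<subseteq> A} = (\<lambda>(a, as). a # as) ` (A \<times> {as. length as = n \<and> set as \<subseteq> A})"
    by (auto simp: length_Suc_conv image_iff)
  moreover have "inj_on (\<lambda>(a, as). a # as) (A \<times> {as. length as = n \<and> set as \<subseteq> A})"
    by (auto simp: inj_on_def)
  ultimately show ?thesis
    by (simp add: sum.reindex sum.cartesian_product case_prod_unfold comp_def)
qed

lemma sum_paths_eq_matrix_word:
  assumes "j \<in> {1..N}" "w \<noteq> []"
  shows "(\<Sum>as | length as = length w - 1 \<and> set as \<subseteq> {1..N}.
      prod_list (map (\<lambda>m. unit_gen L N ((i # as) ! m) ((as @ [j]) ! m) (w ! m)) [0..<length w])) =
    matrix_word L N i j w"
  using assms(2)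
proof (induction w arbitrary: i)
  case (Cons \<alpha> w)
  show ?case
  proof (cases "w = []")
    case True
    have "{as. as = [] \<and> set as \<subseteq> {1..N}} = {[]}" by auto
    moreover have "(\<Sum>a = 1..N. unit_gen L N i a \<alpha> * of_bool (a = j)) = (\<Sum>a = 1..N. if a = j then unit_gen L N i a \<alpha> else 0)"
      by (intro sum.cong) auto
    ultimately show ?thesis using True assms(1) by simp
  next
    case False
    let ?f = "\<lambda>i as w m. unit_gen L N ((i # as) ! m) ((as @ [j]) ! m) (w ! m)"
    let ?A = "\<lambda>n. {as. length as = n \<and> set as \<subseteq> {1..N}}"
    have "(\<Sum>as\<in>?A (length (\<alpha> # w) - 1). prod_list (map (?f i as (\<alpha> # w)) [0..<length (\<alpha> # w)]))
      = (\<Sum>as\<in>?A (Suc (length w - 1)). prod_list (map (?f i as (\<alpha> # w)) [0..<Suc (length w)]))"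
      using False by simp
    also have "\<dots> = (\<Sum>a=1..N. \<Sum>as\<in>?A (length w - 1). prod_list (map (?f i (a # as) (\<alpha> # w)) [0..<Suc (length w)]))"
      by (rule sum_lists_Suc) simp
    also have "\<dots> = (\<Sum>a=1..N. unit_gen L N i a \<alpha> * (\<Sum>as\<in>?A (length w - 1). prod_list (map (?f a as w) [0..<length w])))"
      by (simp add: sum_distrib_left map_upt_Suc del: upt_Suc)
    also have "\<dots> = matrix_word L N i j (\<alpha> # w)"
      using Cons.IH[OF False] by simp
    finally show ?thesis .
  qed
qed simp

lemma e_word_eq_cls:
  assumes "j \<in> {1..N}"
  shows "e_word L N i j w = UG.cls L N (matrix_word L N i j w)"
proof (cases "w = []")
  case True
  then show ?thesis by (simp add: e_word_def U_gl_def UG.cls_one UG.cls_zero)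
next
  case False
  have E: "E_gen L N a b \<alpha> = UG.cls L N (unit_gen L N a b \<alpha>)" for a b \<alpha>
    by (simp add: E_gen_def uea_of_def UG.cls_def unit_gen_def gl_unit_def)
  have "prod_list_in (U_gl L N) (map (\<lambda>m. E_gen L N ((i # as) ! m) ((as @ [j]) ! m) (w ! m)) [0..<length w])
    = UG.cls L N (prod_list (map (\<lambda>m. unit_gen L N ((i # as) ! m) ((as @ [j]) ! m) (w ! m)) [0..<length w]))" for as
  proof -
    let ?ps = "map (\<lambda>m. unit_gen L N ((i # as) ! m) ((as @ [j]) ! m) (w ! m)) [0..<length w]"
    have "prod_list_in (uea (lie_power L (gl N))) (map (UG.cls L N) ?ps) = UG.cls L N (prod_list ?ps)"
      by (rule UG.cls_prod_list) auto
    then show ?thesis by (simp add: E U_gl_def comp_def)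
  qed
  then have "e_word L N i j w = (\<Oplus>\<^bsub>U_gl L N\<^esub> as \<in> {as. length as = length w - 1 \<and> set as \<subseteq> {1..N}}.
    UG.cls L N (prod_list (map (\<lambda>m. unit_gen L N ((i # as) ! m) ((as @ [j]) ! m) (w ! m)) [0..<length w])))"
    using False by (simp add: e_word_def)
  also have "\<dots> = UG.cls L N (\<Sum>as | length as = length w - 1 \<and> set as \<subseteq> {1..N}.
    prod_list (map (\<lambda>m. unit_gen L N ((i # as) ! m) ((as @ [j]) ! m) (w ! m)) [0..<length w]))"
    unfolding U_gl_def by (rule UG.cls_sum) (auto intro!: prod_list_carrier)
  finally show ?thesis using sum_paths_eq_matrix_word[OF assms False] by simp
qed

lemma coeff_sum_eq_cls:
  assumes "j \<in> {1..N}" "l \<in> {1..N}"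
  shows "coeff_sum L N S c i j k l =
    UG.cls L N (\<Sum>z\<in>S. of_int (c z) * (matrix_word L N i j (fst z) * matrix_word L N k l (snd z)))"
proof -
  have "coeff_sum L N S c i j k l = (\<Oplus>\<^bsub>uea (lie_power L (gl N))\<^esub> z \<in> S.
     UG.cls L N (of_int (c z) * (matrix_word L N i j (fst z) * matrix_word L N k l (snd z))))"
    unfolding coeff_sum_def U_gl_def e_word_eq_cls[OF assms(1)] e_word_eq_cls[OF assms(2)]
    by (simp add: UG.cls_mult UG.cls_int_multiple mult_carrier)
  also have "\<dots> = UG.cls L N (\<Sum>z\<in>S. of_int (c z) * (matrix_word L N i j (fst z) * matrix_word L N k l (snd z)))"
    by (rule UG.cls_sum) (auto intro!: mult_carrier)
  finally show ?thesis .
qed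

section \<open>Interleaving two chains of matrix units\<close>

text \<open>
  The list gives the factors in the order of multiplication. A letter tagged with \<^term>\<open>True\<close>
  belongs to the chain from \<open>i\<close> to \<open>j\<close>, a letter tagged with \<^term>\<open>False\<close> to the chain from \<open>k\<close>
  to \<open>l\<close>; consecutive letters of a chain share a summation index.
\<close>

fun shuffle :: "nat \<Rightarrow> nat \<Rightarrow> (nat \<times> bool) list \<Rightarrow> nat \<Rightarrow> nat \<Rightarrow> nat \<Rightarrow> nat \<Rightarrow> gl_element" where
  "shuffle L N [] i j k l = of_bool (i = j \<and> k = l)"
| "shuffle L N ((\<alpha>, b) # s) i j k l =
    (if b then \<Sum>a=1..N. unit_gen L N i a \<alpha> * shuffle L N s a j k l
     else \<Sum>a=1..N. unit_gen L N k a \<alpha> * shuffle L N s i j a l)"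

definition flip :: "(nat \<times> bool) list \<Rightarrow> (nat \<times> bool) list" where
  "flip = map (apsnd Not)"

lemma length_flip [simp]: "length (flip s) = length s"
  by (simp add: flip_def)

lemma shuffle_carrier [simp]: "shuffle L N s i j k l \<in> carrier (UG.F L N)"
  by (induction s arbitrary: i k) (auto intro!: sum_carrier mult_carrier)

lemma shuffle_flip: "shuffle L N (flip s) i j k l = shuffle L N s k l i j"
  by (induction s arbitrary: i k) (auto simp: flip_def)

lemma shuffle_first_path: "shuffle L N (map (\<lambda>\<alpha>. (\<alpha>, True)) x) i j k l = matrix_word L N i j x * of_bool (k = l)"
  by (induction x arbitrary: i) (auto simp: sum_distrib_right mult.assoc)

lemma shuffle_first_then_second:
  "shuffle L N (map (\<lambda>\<alpha>. (\<alpha>, True)) x @ map (\<lambda>\<alpha>. (\<alpha>, False)) y) i j k l = matrix_word L N i j x * matrix_word L N k l y"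
proof (induction x arbitrary: i)
  case Nil
  show ?case using shuffle_first_path[of L N y k l i j] shuffle_flip[of L N "map (\<lambda>\<alpha>. (\<alpha>, True)) y" i j k l]
    by (cases "i = j") (simp_all add: flip_def comp_def)
qed (simp add: sum_distrib_right mult.assoc)

lemma shuffle_second_then_first:
  "shuffle L N (map (\<lambda>\<alpha>. (\<alpha>, False)) y @ map (\<lambda>\<alpha>. (\<alpha>, True)) x) i j k l = matrix_word L N k l y * matrix_word L N i j x"
  using shuffle_first_then_second[of L N y x k l i j]
    shuffle_flip[of L N "map (\<lambda>\<alpha>. (\<alpha>, True)) y @ map (\<lambda>\<alpha>. (\<alpha>, False)) x" i j k l]
  by (simp add: flip_def comp_def)

text \<open>
  The commutator of \<open>E\<^sub>i\<^sub>a\<close> and \<open>E\<^sub>k\<^sub>b\<close> forces \<open>a = k\<close> or \<open>b = i\<close>. What remains is one factor,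
  \<open>E\<^sub>i\<^sub>b\<close> or \<open>E\<^sub>k\<^sub>a\<close>, and in either case the chain that starts at \<open>i\<close> goes on along the former tail
  of the chain that starts at \<open>k\<close>, and conversely. This crossing is the reason for flipping
  the tags of all later letters and for interchanging \<open>j\<close> and \<open>l\<close>.
\<close>

lemma shuffle_exchange_front:
  assumes "i \<in> {1..N}" "k \<in> {1..N}"
  shows "UG.cong L N (shuffle L N ((\<alpha>, True) # (\<beta>, False) # s) i j k l - shuffle L N ((\<beta>, False) # (\<alpha>, True) # s) i j k l)
    (if \<alpha> = \<beta> then shuffle L N ((\<alpha>, True) # flip s) i l k j - shuffle L N ((\<alpha>, False) # flip s) i l k j else 0)"
proof -
  let ?E = "unit_gen L N" and ?S = "\<lambda>a b. shuffle L N s a j b l"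
  have split: "(of_bool (\<alpha> = \<beta> \<and> a = k) * ?E i b \<alpha> - of_bool (\<alpha> = \<beta> \<and> b = i) * ?E k a \<alpha>) * ?S a b
      = (if a = k then of_bool (\<alpha> = \<beta>) * ?E i b \<alpha> * ?S a b else 0)
        - (if b = i then of_bool (\<alpha> = \<beta>) * ?E k a \<alpha> * ?S a b else 0)" for a b
    by (cases "a = k"; cases "b = i") (simp_all add: left_diff_distrib)
  have lhs: "shuffle L N ((\<alpha>, True) # (\<beta>, False) # s) i j k l - shuffle L N ((\<beta>, False) # (\<alpha>, True) # s) i j k l
    = (\<Sum>a=1..N. \<Sum>b=1..N. (?E i a \<alpha> * ?E k b \<beta> - ?E k b \<beta> * ?E i a \<alpha>) * ?S a b)"
  proof -
    have "shuffle L N ((\<beta>, False) # (\<alpha>, True) # s) i j k l = (\<Sum>a=1..N. \<Sum>b=1..N. ?E k b \<beta> * (?E i a \<alpha> * ?S a b))"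
      unfolding shuffle.simps if_True if_False sum_distrib_left by (rule sum.swap)
    then show ?thesis
      by (simp only: shuffle.simps if_True if_False sum_distrib_left left_diff_distrib sum_subtractf mult.assoc)
  qed
  have rhs: "(\<Sum>a=1..N. \<Sum>b=1..N.
      (of_bool (\<alpha> = \<beta> \<and> a = k) * ?E i b \<alpha> - of_bool (\<alpha> = \<beta> \<and> b = i) * ?E k a \<alpha>) * ?S a b)
    = (if \<alpha> = \<beta> then shuffle L N ((\<alpha>, True) # flip s) i l k j - shuffle L N ((\<alpha>, False) # flip s) i l k j else 0)"
  proof -
    have "(\<Sum>a=1..N. \<Sum>b=1..N. if a = k then of_bool (\<alpha> = \<beta>) * ?E i b \<alpha> * ?S a b else 0)
      = (\<Sum>b=1..N. of_bool (\<alpha> = \<beta>) * ?E i b \<alpha> * ?S k b)"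
      using assms(2) by (subst sum.swap) simp
    moreover have "(\<Sum>a=1..N. \<Sum>b=1..N. if b = i then of_bool (\<alpha> = \<beta>) * ?E k a \<alpha> * ?S a b else 0)
      = (\<Sum>a=1..N. of_bool (\<alpha> = \<beta>) * ?E k a \<alpha> * ?S a i)"
      using assms(1) by simp
    ultimately show ?thesis
      unfolding split sum_subtractf by (simp add: shuffle_flip)
  qed
  have "UG.cong L N (\<Sum>a=1..N. \<Sum>b=1..N. (?E i a \<alpha> * ?E k b \<beta> - ?E k b \<beta> * ?E i a \<alpha>) * ?S a b)
    (\<Sum>a=1..N. \<Sum>b=1..N.
      (of_bool (\<alpha> = \<beta> \<and> a = k) * ?E i b \<alpha> - of_bool (\<alpha> = \<beta> \<and> b = i) * ?E k a \<alpha>) * ?S a b)"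
    using assms by (intro UG.cong_sum UG.cong_mult_right unit_gen_commutator) auto
  then show ?thesis unfolding lhs rhs .
qed

lemma shuffle_exchange:
  assumes "i \<in> {1..N}" "k \<in> {1..N}"
  shows "UG.cong L N (shuffle L N (p @ (\<alpha>, True) # (\<beta>, False) # s) i j k l - shuffle L N (p @ (\<beta>, False) # (\<alpha>, True) # s) i j k l)
    (if \<alpha> = \<beta> then shuffle L N (p @ (\<alpha>, True) # flip s) i l k j - shuffle L N (p @ (\<alpha>, False) # flip s) i l k j else 0)"
  using assms
proof (induction p arbitrary: i k)
  case Nil
  then show ?case unfolding append_Nil by (rule shuffle_exchange_front)
next
  case (Cons x p)
  let ?D = "\<lambda>i k. shuffle L N (p @ (\<alpha>, True) # (\<beta>, False) # s) i j k l - shuffle L N (p @ (\<beta>, False) # (\<alpha>, True) # s) i j k l"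
  let ?R = "\<lambda>i k. if \<alpha> = \<beta> then shuffle L N (p @ (\<alpha>, True) # flip s) i l k j - shuffle L N (p @ (\<alpha>, False) # flip s) i l k j else 0"
  obtain \<gamma> b where x: "x = (\<gamma>, b)" by (cases x)
  have "UG.cong L N (\<Sum>a=1..N. unit_gen L N i a \<gamma> * ?D a k) (\<Sum>a=1..N. unit_gen L N i a \<gamma> * ?R a k)"
   and "UG.cong L N (\<Sum>a=1..N. unit_gen L N k a \<gamma> * ?D i a) (\<Sum>a=1..N. unit_gen L N k a \<gamma> * ?R i a)"
    using Cons by (auto intro!: UG.cong_sum UG.cong_mult_left simp del: shuffle.simps)
  then show ?case
    by (cases "\<alpha> = \<beta>"; cases b) (simp_all add: x right_diff_distrib sum_subtractf del: One_nat_def)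
qed

section \<open>Existence of expansions\<close>

text \<open>
  The moves under which shuffles change only by shorter shuffles.
\<close>

inductive exchange :: "(nat \<times> bool) list \<Rightarrow> (nat \<times> bool) list \<Rightarrow> bool" where
  exchangeI: "exchange (p @ (\<alpha>, True) # (\<beta>, False) # s) (p @ (\<beta>, False) # (\<alpha>, True) # s)"

lemma exchange_equiv_context:
  assumes "equivclp exchange s t"
  shows "equivclp exchange (p @ s @ q) (p @ t @ q)"
proof -
  have ctx: "exchange (p @ s @ q) (p @ t @ q)" if "exchange s t" for s t
    using that
  proof cases
    case (exchangeI p' \<alpha> \<beta> s')
    then show ?thesis using exchange.exchangeI[of "p @ p'" \<alpha> \<beta> "s' @ q"] by simp
  qed
  from assms show ?thesis
  proof (induction rule: equivclp_induct)
    case (step t u)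
    then have "equivclp exchange (p @ t @ q) (p @ u @ q)"
      using ctx by (auto intro: equivclp_sym)
    with step.IH show ?case by (rule equivclp_trans)
  qed simp
qed

lemma exchange_mset: "exchange s t \<Longrightarrow> mset s = mset t"
  by (auto elim!: exchange.cases)

lemma exchange_equiv_mset: "equivclp exchange s t \<Longrightarrow> mset s = mset t"
  by (induction rule: equivclp_induct) (auto dest: exchange_mset)

lemma exchange_move:
  "(\<And>x. x \<in> set u \<Longrightarrow> snd x) \<Longrightarrow> equivclp exchange ((\<beta>, False) # u) (u @ [(\<beta>, False)])"
proof (induction u)
  case (Cons x u)
  obtain \<alpha> where x: "x = (\<alpha>, True)" using Cons.prems[of x] by (cases x) auto
  have "equivclp exchange ((\<beta>, False) # x # u) (x # (\<beta>, False) # u)"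
    using exchangeI[of "[]" \<alpha> \<beta> u] x by (auto intro: equivclp_sym)
  also have "equivclp exchange (x # (\<beta>, False) # u) (x # u @ [(\<beta>, False)])"
    using exchange_equiv_context[of _ _ "[x]" "[]"] Cons by simp
  finally show ?case by simp
qed simp

lemma exchange_sort: "equivclp exchange s (filter snd s @ filter (\<lambda>x. \<not> snd x) s)"
proof (induction s)
  case (Cons x s)
  have 1: "equivclp exchange (x # s) (x # filter snd s @ filter (\<lambda>x. \<not> snd x) s)"
    using exchange_equiv_context[OF Cons.IH, of "[x]" "[]"] by simp
  show ?case
  proof (cases "snd x")
    case False
    then obtain \<beta> where x: "x = (\<beta>, False)" by (cases x) auto
    have "equivclp exchange ((x # filter snd s) @ filter (\<lambda>x. \<not> snd x) s) ((filter snd s @ [x]) @ filter (\<lambda>x. \<not> snd x) s)"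
      using exchange_equiv_context[OF exchange_move[of "filter snd s" \<beta>], of "[]"] x by simp
    with 1 show ?thesis using False by (auto intro: equivclp_trans)
  qed (use 1 in simp)
qed simp

lemma exchange_equivI:
  assumes "filter snd s = filter snd t" "filter (\<lambda>x. \<not> snd x) s = filter (\<lambda>x. \<not> snd x) t"
  shows "equivclp exchange s t"
  using exchange_sort[of s] exchange_sort[of t] assms by (metis equivclp_sym equivclp_trans)

text \<open>
  The pairs that index the possible terms of an expansion. The pair of empty words is excluded:
  an exchange merges two letters into one, so the last letter is never lost.
\<close>

definition word_pairs :: "nat \<Rightarrow> nat \<Rightarrow> (nat list \<times> nat list) set" where
  "word_pairs L n = {(x, y). set x \<subseteq> {1..L} \<and> set y \<subseteq> {1..L} \<and> 0 < length x + length y \<and> length x + length y \<le> n}"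

definition pair_length :: "nat list \<times> nat list \<Rightarrow> nat" where
  "pair_length z = length (fst z) + length (snd z)"

lemma finite_word_pairs [simp]: "finite (word_pairs L n)"
proof (rule finite_subset)
  let ?W = "{x. set x \<subseteq> {1..L} \<and> length x \<le> n}"
  show "word_pairs L n \<subseteq> ?W \<times> ?W" by (auto simp: word_pairs_def)
  show "finite (?W \<times> ?W)" using finite_lists_length_le[of "{1..L}" n] by blast
qed

lemma word_pairs_mono: "m \<le> n \<Longrightarrow> word_pairs L m \<subseteq> word_pairs L n"
  by (auto simp: word_pairs_def)

definition ordered_product ::
  "nat \<Rightarrow> nat \<Rightarrow> bool \<Rightarrow> nat list \<times> nat list \<Rightarrow> nat \<Rightarrow> nat \<Rightarrow> nat \<Rightarrow> nat \<Rightarrow> gl_element" where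
  "ordered_product L N b z i j k l =
    (if b then matrix_word L N i j (fst z) * matrix_word L N k l (snd z)
     else matrix_word L N k l (fst z) * matrix_word L N i j (snd z))"

text \<open>
  A term with uncrossed ends if its length has the parity \<open>par\<close>, and with crossed ends
  otherwise. The flags \<open>be\<close> and \<open>bo\<close> choose the order of the two factors in these two cases; their
  four values are the four forms of the expansion.
\<close>

definition basis_product ::
  "nat \<Rightarrow> nat \<Rightarrow> bool \<Rightarrow> bool \<Rightarrow> bool \<Rightarrow> nat list \<times> nat list \<Rightarrow> nat \<Rightarrow> nat \<Rightarrow> nat \<Rightarrow> nat \<Rightarrow> gl_element" where
  "basis_product L N be bo par z i j k l =
    (if even (pair_length z) = par then ordered_product L N be z i j k l else ordered_product L N bo z i l k j)"

definition expansion ::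
  "nat \<Rightarrow> nat \<Rightarrow> bool \<Rightarrow> bool \<Rightarrow> bool \<Rightarrow> nat \<Rightarrow> (nat list \<times> nat list \<Rightarrow> int) \<Rightarrow>
    nat \<Rightarrow> nat \<Rightarrow> nat \<Rightarrow> nat \<Rightarrow> gl_element" where
  "expansion L N be bo par n c i j k l =
     (\<Sum>z\<in>word_pairs L n. of_int (c z) * basis_product L N be bo par z i j k l)"

text \<open>
  The coefficients are chosen before \<open>N\<close> and the indices, so they depend on neither.
\<close>

definition expandable ::
  "nat \<Rightarrow> bool \<Rightarrow> bool \<Rightarrow> bool \<Rightarrow> nat \<Rightarrow> (nat \<Rightarrow> nat \<Rightarrow> nat \<Rightarrow> nat \<Rightarrow> nat \<Rightarrow> gl_element) \<Rightarrow> bool" where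
  "expandable L be bo par n F \<longleftrightarrow> (\<exists>c :: _ \<Rightarrow> int. \<forall>N. \<forall>i\<in>{1..N}. \<forall>j\<in>{1..N}. \<forall>k\<in>{1..N}. \<forall>l\<in>{1..N}.
     UG.cong L N (F N i j k l) (expansion L N be bo par n c i j k l))"

lemma expandableI:
  assumes "\<And>N i j k l. i \<in> {1..N} \<Longrightarrow> j \<in> {1..N} \<Longrightarrow> k \<in> {1..N} \<Longrightarrow> l \<in> {1..N} \<Longrightarrow>
      UG.cong L N (F N i j k l) (expansion L N be bo par n c i j k l)"
  shows "expandable L be bo par n F"
  using assms unfolding expandable_def by blast

lemma expandableE:
  assumes "expandable L be bo par n F"
  obtains c where "\<And>N i j k l. i \<in> {1..N} \<Longrightarrow> j \<in> {1..N} \<Longrightarrow> k \<in> {1..N} \<Longrightarrow> l \<in> {1..N} \<Longrightarrow>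
      UG.cong L N (F N i j k l) (expansion L N be bo par n c i j k l)"
  using assms unfolding expandable_def by blast

lemma expandable_zero: "expandable L be bo par n (\<lambda>N i j k l. 0)"
  by (rule expandableI[where c = "\<lambda>_. 0"]) (simp add: expansion_def)

lemma expansion_add:
  "expansion L N be bo par n (\<lambda>z. c z + d z) i j k l =
    expansion L N be bo par n c i j k l + expansion L N be bo par n d i j k l"
  by (simp add: expansion_def distrib_right sum.distrib)

lemma expansion_diff:
  "expansion L N be bo par n (\<lambda>z. c z - d z) i j k l =
    expansion L N be bo par n c i j k l - expansion L N be bo par n d i j k l"
  by (simp only: expansion_def of_int_diff left_diff_distrib sum_subtractf)

lemma expandable_add:
  assumes "expandable L be bo par n F" "expandable L be bo par n G"
  shows "expandable L be bo par n (\<lambda>N i j k l. F N i j k l + G N i j k l)"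
proof (rule expandableE[OF assms(1)], rule expandableE[OF assms(2)], rule expandableI)
  fix c d and N i j k l :: nat
  assume "\<And>N i j k l. i \<in> {1..N} \<Longrightarrow> j \<in> {1..N} \<Longrightarrow> k \<in> {1..N} \<Longrightarrow> l \<in> {1..N} \<Longrightarrow>
      UG.cong L N (F N i j k l) (expansion L N be bo par n c i j k l)"
    and "\<And>N i j k l. i \<in> {1..N} \<Longrightarrow> j \<in> {1..N} \<Longrightarrow> k \<in> {1..N} \<Longrightarrow> l \<in> {1..N} \<Longrightarrow>
      UG.cong L N (G N i j k l) (expansion L N be bo par n d i j k l)"
    and "i \<in> {1..N}" "j \<in> {1..N}" "k \<in> {1..N}" "l \<in> {1..N}"
  then show "UG.cong L N (F N i j k l + G N i j k l) (expansion L N be bo par n (\<lambda>z. c z + d z) i j k l)"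
    unfolding expansion_add by (intro UG.cong_add)
qed

lemma expandable_diff:
  assumes "expandable L be bo par n F" "expandable L be bo par n G"
  shows "expandable L be bo par n (\<lambda>N i j k l. F N i j k l - G N i j k l)"
proof (rule expandableE[OF assms(1)], rule expandableE[OF assms(2)], rule expandableI)
  fix c d and N i j k l :: nat
  assume "\<And>N i j k l. i \<in> {1..N} \<Longrightarrow> j \<in> {1..N} \<Longrightarrow> k \<in> {1..N} \<Longrightarrow> l \<in> {1..N} \<Longrightarrow>
      UG.cong L N (F N i j k l) (expansion L N be bo par n c i j k l)"
    and "\<And>N i j k l. i \<in> {1..N} \<Longrightarrow> j \<in> {1..N} \<Longrightarrow> k \<in> {1..N} \<Longrightarrow> l \<in> {1..N} \<Longrightarrow>
      UG.cong L N (G N i j k l) (expansion L N be bo par n d i j k l)"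
    and "i \<in> {1..N}" "j \<in> {1..N}" "k \<in> {1..N}" "l \<in> {1..N}"
  then show "UG.cong L N (F N i j k l - G N i j k l) (expansion L N be bo par n (\<lambda>z. c z - d z) i j k l)"
    unfolding expansion_diff by (intro UG.cong_diff)
qed

lemma expandable_cong:
  assumes "expandable L be bo par n F"
    and "\<And>N i j k l. i \<in> {1..N} \<Longrightarrow> j \<in> {1..N} \<Longrightarrow> k \<in> {1..N} \<Longrightarrow> l \<in> {1..N} \<Longrightarrow>
      UG.cong L N (G N i j k l) (F N i j k l)"
  shows "expandable L be bo par n G"
  using assms(1) by (rule expandableE) (rule expandableI, rule UG.cong_trans[OF assms(2)])

lemma expandable_mono:
  assumes "expandable L be bo par m F" "m \<le> n"
  shows "expandable L be bo par n F"
proof (rule expandableE[OF assms(1)])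
  fix c
  assume c: "\<And>N i j k l. i \<in> {1..N} \<Longrightarrow> j \<in> {1..N} \<Longrightarrow> k \<in> {1..N} \<Longrightarrow> l \<in> {1..N} \<Longrightarrow>
      UG.cong L N (F N i j k l) (expansion L N be bo par m c i j k l)"
  define d where "d z = (if z \<in> word_pairs L m then c z else 0)" for z
  have "expansion L N be bo par n d i j k l = expansion L N be bo par m c i j k l" for N i j k l
    unfolding expansion_def using word_pairs_mono[OF assms(2), of L]
    by (intro sum.mono_neutral_cong_right) (auto simp: d_def)
  with c show ?thesis by (intro expandableI[where c = d]) simp
qed

text \<open>
  Interchanging \<open>j\<close> and \<open>l\<close> turns uncrossed ends into crossed ones. This exchanges the roles of
  the two order flags and reverses the parity.
\<close>

lemma expandable_swap_ends:
  assumes "expandable L bo be (\<not> par) n F"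
  shows "expandable L be bo par n (\<lambda>N i j k l. F N i l k j)"
proof (rule expandableE[OF assms])
  fix c
  assume c: "\<And>N i j k l. i \<in> {1..N} \<Longrightarrow> j \<in> {1..N} \<Longrightarrow> k \<in> {1..N} \<Longrightarrow> l \<in> {1..N} \<Longrightarrow>
      UG.cong L N (F N i j k l) (expansion L N bo be (\<not> par) n c i j k l)"
  have "expansion L N bo be (\<not> par) n c i l k j = expansion L N be bo par n c i j k l" for N i j k l
    unfolding expansion_def basis_product_def by (intro sum.cong) auto
  with c show ?thesis by (intro expandableI[where c = c]) metis
qed

lemma expandable_ordered_product:
  assumes "z \<in> word_pairs L n" "even (pair_length z) = par"
  shows "expandable L be bo par n (\<lambda>N i j k l. ordered_product L N be z i j k l)"
proof (rule expandableI[where c = "\<lambda>z'. of_bool (z' = z)"])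
  fix N i j k l
  have "expansion L N be bo par n (\<lambda>z'. of_bool (z' = z)) i j k l
    = (\<Sum>z'\<in>word_pairs L n. if z' = z then basis_product L N be bo par z' i j k l else 0)"
    unfolding expansion_def by (intro sum.cong) auto
  also have "\<dots> = ordered_product L N be z i j k l" using assms by (simp add: basis_product_def)
  finally show "UG.cong L N (ordered_product L N be z i j k l)
      (expansion L N be bo par n (\<lambda>z'. of_bool (z' = z)) i j k l)" by simp
qed

text \<open>
  The error of a single exchange consists of shuffles with one letter less and crossed ends. The
  induction hypothesis applies to them with the two order flags interchanged, which is why it has
  to be available for all values of the flags.
\<close>

lemma expandable_exchange_step:
  assumes IH: "\<And>s be bo. s \<noteq> [] \<Longrightarrow> Suc (length s) = n \<Longrightarrow> fst ` set s \<subseteq> {1..L} \<Longrightarrow>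
      expandable L be bo (even (length s)) (length s) (\<lambda>N. shuffle L N s)"
    and "exchange s t" "length s = n" "fst ` set s \<subseteq> {1..L}"
  shows "expandable L be bo (even n) (n - 1) (\<lambda>N i j k l. shuffle L N s i j k l - shuffle L N t i j k l)"
  using assms(2)
proof cases
  case (exchangeI p \<alpha> \<beta> q)
  have n: "n = Suc (Suc (length p + length q))" using exchangeI assms(3) by simp
  have swapped: "expandable L be bo (even n) (n - 1) (\<lambda>N i j k l. shuffle L N (p @ (\<alpha>, b) # flip q) i l k j)" for b
  proof -
    have "expandable L bo be (even (n - 1)) (n - 1) (\<lambda>N. shuffle L N (p @ (\<alpha>, b) # flip q))"
      using IH[of "p @ (\<alpha>, b) # flip q" bo be] exchangeI(1) assms(4) by (simp add: n flip_def image_Un image_image)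
    moreover have "even (n - 1) = (\<not> even n)" using n by simp
    ultimately have "expandable L bo be (\<not> even n) (n - 1) (\<lambda>N. shuffle L N (p @ (\<alpha>, b) # flip q))"
      by (simp only:)
    then show ?thesis by (rule expandable_swap_ends)
  qed
  have "expandable L be bo (even n) (n - 1)
      (\<lambda>N i j k l. if \<alpha> = \<beta> then shuffle L N (p @ (\<alpha>, True) # flip q) i l k j - shuffle L N (p @ (\<alpha>, False) # flip q) i l k j else 0)"
  proof (cases "\<alpha> = \<beta>")
    case True
    show ?thesis unfolding if_P[OF True] by (rule expandable_diff) (rule swapped)+
  next
    case False
    show ?thesis unfolding if_not_P[OF False] by (rule expandable_zero)
  qed
  then show ?thesis
    unfolding exchangeI(1,2) by (rule expandable_cong) (rule shuffle_exchange)
qed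

lemma expandable_exchange:
  assumes IH: "\<And>s be bo. s \<noteq> [] \<Longrightarrow> Suc (length s) = n \<Longrightarrow> fst ` set s \<subseteq> {1..L} \<Longrightarrow>
      expandable L be bo (even (length s)) (length s) (\<lambda>N. shuffle L N s)"
    and eq: "equivclp exchange s t" and s: "length s = n" "fst ` set s \<subseteq> {1..L}"
  shows "expandable L be bo (even n) (n - 1) (\<lambda>N i j k l. shuffle L N s i j k l - shuffle L N t i j k l)"
  using eq
proof (induction rule: equivclp_induct)
  case base
  then show ?case by (simp add: expandable_zero)
next
  case (step t u)
  have m: "mset t = mset s" "mset u = mset s"
    using step.hyps exchange_equiv_mset[of s t] exchange_mset[of t u] exchange_mset[of u t] by auto
  then have t: "length t = n" "fst ` set t \<subseteq> {1..L}" and u: "length u = n" "fst ` set u \<subseteq> {1..L}"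
    using s by (auto dest: mset_eq_length mset_eq_setD)
  have "expandable L be bo (even n) (n - 1) (\<lambda>N i j k l. shuffle L N t i j k l - shuffle L N u i j k l)"
    using step.hyps(2)
  proof
    assume "exchange t u"
    show ?thesis
      by (rule expandable_exchange_step[OF _ \<open>exchange t u\<close> t]) (rule IH)
  next
    assume "exchange u t"
    have "expandable L be bo (even n) (n - 1) (\<lambda>N i j k l. shuffle L N u i j k l - shuffle L N t i j k l)"
      by (rule expandable_exchange_step[OF _ \<open>exchange u t\<close> u]) (rule IH)
    then have "expandable L be bo (even n) (n - 1) (\<lambda>N i j k l. 0 - (shuffle L N u i j k l - shuffle L N t i j k l))"
      by (rule expandable_diff[OF expandable_zero])
    then show ?thesis by (simp only: diff_0 minus_diff_eq)
  qed
  with step.IH have "expandable L be bo (even n) (n - 1)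
      (\<lambda>N i j k l. (shuffle L N s i j k l - shuffle L N t i j k l) + (shuffle L N t i j k l - shuffle L N u i j k l))"
    by (rule expandable_add)
  then show ?case by (simp only: diff_add_cancel add_diff_eq)
qed

text \<open>
  Sorting the tags, with the chain that \<open>be\<close> selects in front, leaves a single product of two
  words; the errors of the exchanges on the way there are shorter and covered by the induction
  hypothesis.
\<close>

lemma expandable_shuffle:
  assumes "s \<noteq> []" "fst ` set s \<subseteq> {1..L}"
  shows "expandable L be bo (even (length s)) (length s) (\<lambda>N. shuffle L N s)"
  using assms
proof (induction "length s" arbitrary: s be bo rule: less_induct)
  case less
  define x where "x = map fst (filter snd s)"
  define y where "y = map fst (filter (\<lambda>x. \<not> snd x) s)"
  define t where "t = (if be then map (\<lambda>\<alpha>. (\<alpha>, True)) x @ map (\<lambda>\<alpha>. (\<alpha>, False)) y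
    else map (\<lambda>\<alpha>. (\<alpha>, False)) y @ map (\<lambda>\<alpha>. (\<alpha>, True)) x)"
  define z where "z = (if be then (x, y) else (y, x))"
  have T: "map (\<lambda>\<alpha>. (\<alpha>, True)) x = filter snd s" unfolding x_def map_map
    by (rule map_idI) auto
  have F: "map (\<lambda>\<alpha>. (\<alpha>, False)) y = filter (\<lambda>x. \<not> snd x) s" unfolding y_def map_map
    by (rule map_idI) auto
  have "filter snd t = filter snd s" "filter (\<lambda>x. \<not> snd x) t = filter (\<lambda>x. \<not> snd x) s"
    unfolding t_def T F by (auto simp: filter_empty_conv)
  then have st: "equivclp exchange s t" by (intro exchange_equivI) simp_all
  have len: "length x + length y = length s"
    using sum_length_filter_compl[of snd s] by (simp add: x_def y_def)
  have z: "z \<in> word_pairs L (length s)" "pair_length z = length s"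
    using less.prems len by (auto simp: z_def word_pairs_def pair_length_def x_def y_def)
  have "(\<lambda>N. shuffle L N t) = (\<lambda>N. ordered_product L N be z)"
    by (intro ext) (simp add: t_def z_def ordered_product_def shuffle_first_then_second shuffle_second_then_first)
  then have t: "expandable L be bo (even (length s)) (length s) (\<lambda>N. shuffle L N t)"
    using expandable_ordered_product[OF z(1) refl, of be bo] z(2) by (simp only:)
  have "expandable L be bo (even (length s)) (length s - 1) (\<lambda>N i j k l. shuffle L N s i j k l - shuffle L N t i j k l)"
  proof (rule expandable_exchange[OF _ st refl less.prems(2)])
    fix s' :: "(nat \<times> bool) list" and be' bo'
    assume s': "s' \<noteq> []" "Suc (length s') = length s" "fst ` set s' \<subseteq> {1..L}"
    from s'(2) have "length s' < length s" by linarith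
    from less.hyps[OF this s'(1,3)]
    show "expandable L be' bo' (even (length s')) (length s') (\<lambda>N. shuffle L N s')" .
  qed
  then have "expandable L be bo (even (length s)) (length s) (\<lambda>N i j k l. shuffle L N s i j k l - shuffle L N t i j k l)"
    by (rule expandable_mono) (rule diff_le_self)
  from this t have "expandable L be bo (even (length s)) (length s)
      (\<lambda>N i j k l. (shuffle L N s i j k l - shuffle L N t i j k l) + shuffle L N t i j k l)"
    by (rule expandable_add)
  then show ?case by (simp only: diff_add_cancel)
qed

text \<open>
  The two products are shuffles with the same subword for each tag, so they are linked by
  exchanges, and the terms of full length cancel.
\<close>

lemma expandable_commutator:
  assumes "set w \<subseteq> {1..L}" "set w' \<subseteq> {1..L}"
  shows "expandable L be bo (even (length w + length w')) (length w + length w' - 1)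
    (\<lambda>N i j k l. matrix_word L N i j w * matrix_word L N k l w' - matrix_word L N k l w' * matrix_word L N i j w)"
proof -
  let ?T = "map (\<lambda>\<alpha>. (\<alpha>, True)) w" and ?F = "map (\<lambda>\<alpha>. (\<alpha>, False)) w'"
  have "equivclp exchange (?T @ ?F) (?F @ ?T)"
    by (rule exchange_equivI) (auto simp: comp_def)
  have "expandable L be bo (even (length w + length w')) (length w + length w' - 1)
    (\<lambda>N i j k l. shuffle L N (?T @ ?F) i j k l - shuffle L N (?F @ ?T) i j k l)"
  proof (rule expandable_exchange[OF expandable_shuffle \<open>equivclp exchange (?T @ ?F) (?F @ ?T)\<close>])
    show "fst ` set (?T @ ?F) \<subseteq> {1..L}" using assms by (simp add: image_Un image_image)
  qed simp_all
  then show ?thesis by (simp only: shuffle_first_then_second shuffle_second_then_first)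
qed

section \<open>The action on tensors\<close>

text \<open>
  Matrix entries indexed from 1, extended by zero so that sums over indices need no side
  conditions.
\<close>

definition entry :: "nat \<Rightarrow> complex mat \<Rightarrow> nat \<Rightarrow> nat \<Rightarrow> complex" where
  "entry N A r s = (if r \<in> {1..N} \<and> s \<in> {1..N} then A $$ (r - 1, s - 1) else 0)"

lemma entry_add: "A \<in> carrier_mat N N \<Longrightarrow> B \<in> carrier_mat N N \<Longrightarrow> entry N (A + B) r s = entry N A r s + entry N B r s"
  by (auto simp: entry_def)

lemma entry_minus: "A \<in> carrier_mat N N \<Longrightarrow> B \<in> carrier_mat N N \<Longrightarrow> entry N (A - B) r s = entry N A r s - entry N B r s"
  by (auto simp: entry_def)

lemma entry_smult: "A \<in> carrier_mat N N \<Longrightarrow> entry N (c \<cdot>\<^sub>m A) r s = c * entry N A r s"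
  by (auto simp: entry_def)

lemma entry_zero: "entry N (0\<^sub>m N N) r s = 0"
  by (auto simp: entry_def)

lemma entry_mult:
  assumes "A \<in> carrier_mat N N" "B \<in> carrier_mat N N"
  shows "entry N (A * B) r s = (\<Sum>m=1..N. entry N A r m * entry N B m s)"
proof (cases "r \<in> {1..N} \<and> s \<in> {1..N}")
  case True
  then have "entry N (A * B) r s = (\<Sum>m=0..<N. A $$ (r - 1, m) * B $$ (m, s - 1))"
    using assms by (auto simp: entry_def scalar_prod_def)
  also have "\<dots> = (\<Sum>m=1..N. A $$ (r - 1, m - 1) * B $$ (m - 1, s - 1))"
    by (rule sum.reindex_bij_witness[of _ "\<lambda>m. m - 1" Suc]) auto
  finally show ?thesis using True by (simp add: entry_def)
qed (auto simp: entry_def)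

lemma entry_mat_unit:
  assumes "i \<in> {1..N}" "j \<in> {1..N}"
  shows "entry N (mat_unit N i j) r s = of_bool (r = i \<and> s = j)"
  using assms by (auto simp: entry_def mat_unit_def)

text \<open>
  The action on the tensor product of copies of \<open>\<complex>\<^sup>N\<close>, one for each position of \<open>z\<close>. A tensor is
  given by its coordinate function \<open>f\<close>, whose argument \<open>c\<close> lists the indices of a basis tensor. In
  terms of coordinates the operator reads \<open>f\<close> at the configurations that differ from \<open>c\<close> in one
  position.
\<close>

definition tensor_act :: "nat list \<Rightarrow> nat \<Rightarrow> (nat \<Rightarrow> complex mat) \<Rightarrow> ((nat \<Rightarrow> nat) \<Rightarrow> complex) \<Rightarrow> (nat \<Rightarrow> nat) \<Rightarrow> complex" where
  "tensor_act z N x f c = (\<Sum>t<length z. \<Sum>m=1..N. entry N (x (z ! t)) (c t) m * f (c(t := m)))"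

lemma tensor_act_sum:
  "tensor_act z N x (\<lambda>c. \<Sum>v\<in>V. b v * g v c) c = (\<Sum>v\<in>V. b v * tensor_act z N x (g v) c)"
proof -
  have "tensor_act z N x (\<lambda>c. \<Sum>v\<in>V. b v * g v c) c
    = (\<Sum>t<length z. \<Sum>m=1..N. \<Sum>v\<in>V. b v * (entry N (x (z ! t)) (c t) m * g v (c(t := m))))"
    by (simp add: tensor_act_def sum_distrib_left mult.left_commute)
  also have "\<dots> = (\<Sum>t<length z. \<Sum>v\<in>V. \<Sum>m=1..N. b v * (entry N (x (z ! t)) (c t) m * g v (c(t := m))))"
    by (intro sum.cong refl sum.swap)
  also have "\<dots> = (\<Sum>v\<in>V. \<Sum>t<length z. \<Sum>m=1..N. b v * (entry N (x (z ! t)) (c t) m * g v (c(t := m))))"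
    by (rule sum.swap)
  finally show ?thesis by (simp add: tensor_act_def sum_distrib_left)
qed

lemma foldr_tensor_act_sum:
  "foldr (tensor_act z N) xs (\<lambda>c. \<Sum>v\<in>V. b v * g v c) = (\<lambda>c. \<Sum>v\<in>V. b v * foldr (tensor_act z N) xs (g v) c)"
  by (induction xs) (auto simp: tensor_act_sum)

text \<open>
  In a composition of two operators, the contributions from two different positions are symmetric
  in the operators and cancel in the commutator. The contributions from a single position are
  products of matrices.
\<close>

lemma tensor_act_bracket:
  assumes z: "set z \<subseteq> {1..L}"
    and x: "x \<in> carrier (lie_power L (gl N))" and y: "y \<in> carrier (lie_power L (gl N))"
  shows "tensor_act z N (bracket (lie_power L (gl N)) x y) f c =
    tensor_act z N x (tensor_act z N y f) c - tensor_act z N y (tensor_act z N x f) c"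
proof -
  let ?n = "length z"
  \<comment> \<open>\<open>D\<close> collects the compositions at a single position, \<open>Off\<close> those at two different ones.\<close>
  define D where "D x y t m = entry N (x (z ! t) * y (z ! t)) (c t) m" for x y :: "nat \<Rightarrow> complex mat" and t m
  define Off where "Off x y t s = (if s = t then 0 else
    \<Sum>m=1..N. \<Sum>m'=1..N. entry N (x (z ! t)) (c t) m * (entry N (y (z ! s)) (c s) m' * f (c(t := m, s := m'))))"
    for x y :: "nat \<Rightarrow> complex mat" and t s
  have mats: "x (z ! t) \<in> carrier_mat N N" "y (z ! t) \<in> carrier_mat N N" "z ! t \<in> {1..L}" if "t < ?n" for t
    using x y z nth_mem[OF that] by (auto simp: carrier_lie_power_gl PiE_iff)
  have comp: "tensor_act z N x (tensor_act z N y f) c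
      = (\<Sum>t<?n. \<Sum>m=1..N. D x y t m * f (c(t := m))) + (\<Sum>t<?n. \<Sum>s<?n. Off x y t s)"
    if xy: "\<And>t. t < ?n \<Longrightarrow> x (z ! t) \<in> carrier_mat N N" "\<And>t. t < ?n \<Longrightarrow> y (z ! t) \<in> carrier_mat N N" for x y
  proof -
    have "(\<Sum>m=1..N. entry N (x (z ! t)) (c t) m * tensor_act z N y f (c(t := m)))
      = (\<Sum>m=1..N. D x y t m * f (c(t := m))) + (\<Sum>s<?n. Off x y t s)" if t: "t < ?n" for t
    proof -
      have diag: "(\<Sum>m=1..N. \<Sum>m'=1..N. entry N (x (z ! t)) (c t) m * (entry N (y (z ! t)) m m' * f (c(t := m'))))
        = (\<Sum>m=1..N. D x y t m * f (c(t := m)))"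
        unfolding D_def entry_mult[OF xy(1)[OF t] xy(2)[OF t]]
        by (subst sum.swap) (simp add: sum_distrib_right mult.assoc)
      have "(\<Sum>m=1..N. entry N (x (z ! t)) (c t) m * tensor_act z N y f (c(t := m)))
        = (\<Sum>s<?n. \<Sum>m=1..N. \<Sum>m'=1..N. entry N (x (z ! t)) (c t) m *
            (entry N (y (z ! s)) ((c(t := m)) s) m' * f (c(t := m, s := m'))))"
        unfolding tensor_act_def sum_distrib_left by (rule sum.swap)
      also have "\<dots> = (\<Sum>s<?n. (if s = t then \<Sum>m=1..N. D x y t m * f (c(t := m)) else 0) + Off x y t s)"
        by (intro sum.cong refl) (simp add: Off_def diag del: One_nat_def)
      also have "\<dots> = (\<Sum>m=1..N. D x y t m * f (c(t := m))) + (\<Sum>s<?n. Off x y t s)"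
        using t by (simp add: sum.distrib)
      finally show ?thesis .
    qed
    then show ?thesis by (simp add: tensor_act_def[of z N x] sum.distrib)
  qed
  have "Off x y t s = Off y x s t" for t s
  proof (cases "s = t")
    case False
    have "Off x y t s = (\<Sum>m'=1..N. \<Sum>m=1..N. entry N (x (z ! t)) (c t) m * (entry N (y (z ! s)) (c s) m' * f (c(t := m, s := m'))))"
      unfolding Off_def if_not_P[OF False] by (rule sum.swap)
    also have "\<dots> = Off y x s t"
      using False by (simp add: Off_def mult.left_commute fun_upd_twist[of t s])
    finally show ?thesis .
  qed (simp add: Off_def)
  then have off: "(\<Sum>t<?n. \<Sum>s<?n. Off x y t s) = (\<Sum>t<?n. \<Sum>s<?n. Off y x t s)"
    by (subst sum.swap) simp
  have "tensor_act z N (bracket (lie_power L (gl N)) x y) f c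
    = (\<Sum>t<?n. \<Sum>m=1..N. (D x y t m - D y x t m) * f (c(t := m)))"
    unfolding tensor_act_def
  proof (intro sum.cong refl)
    fix t m assume "t \<in> {..<?n}"
    then have t: "t < ?n" by simp
    note m = mats[OF t]
    show "entry N (bracket (lie_power L (gl N)) x y (z ! t)) (c t) m * f (c(t := m)) = (D x y t m - D y x t m) * f (c(t := m))"
      using m entry_minus[OF mult_carrier_mat[OF m(1,2)] mult_carrier_mat[OF m(2,1)]]
      by (simp add: lie_power_gl_simps D_def)
  qed
  also have "\<dots> = (\<Sum>t<?n. \<Sum>m=1..N. D x y t m * f (c(t := m))) - (\<Sum>t<?n. \<Sum>m=1..N. D y x t m * f (c(t := m)))"
    by (simp add: left_diff_distrib sum_subtractf)
  also have "\<dots> = tensor_act z N x (tensor_act z N y f) c - tensor_act z N y (tensor_act z N x f) c"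
    using comp[of x y] comp[of y x] mats off by simp
  finally show ?thesis .
qed

lemma tensor_act_add:
  assumes z: "set z \<subseteq> {1..L}"
    and x: "x \<in> carrier (lie_power L (gl N))" and y: "y \<in> carrier (lie_power L (gl N))"
  shows "tensor_act z N (x \<oplus>\<^bsub>lie_power L (gl N)\<^esub> y) f c = tensor_act z N x f c + tensor_act z N y f c"
proof -
  have "entry N ((x \<oplus>\<^bsub>lie_power L (gl N)\<^esub> y) (z ! t)) r m = entry N (x (z ! t)) r m + entry N (y (z ! t)) r m"
    if "t < length z" for t r m
    using x y z nth_mem[OF that] by (auto simp: carrier_lie_power_gl PiE_iff lie_power_gl_simps entry_add)
  then show ?thesis by (simp add: tensor_act_def distrib_right sum.distrib)
qed

lemma tensor_act_smult:
  assumes z: "set z \<subseteq> {1..L}" and x: "x \<in> carrier (lie_power L (gl N))"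
  shows "tensor_act z N (a \<odot>\<^bsub>lie_power L (gl N)\<^esub> x) f c = a * tensor_act z N x f c"
proof -
  have "entry N ((a \<odot>\<^bsub>lie_power L (gl N)\<^esub> x) (z ! t)) r m = a * entry N (x (z ! t)) r m"
    if "t < length z" for t r m
    using x z nth_mem[OF that] by (auto simp: carrier_lie_power_gl PiE_iff lie_power_gl_simps entry_smult)
  then show ?thesis by (simp add: tensor_act_def sum_distrib_left mult.assoc)
qed

definition act :: "nat list \<Rightarrow> nat \<Rightarrow> gl_element \<Rightarrow> ((nat \<Rightarrow> nat) \<Rightarrow> complex) \<Rightarrow> (nat \<Rightarrow> nat) \<Rightarrow> complex" where
  "act z N p f c = (\<Sum>u\<in>Poly_Mapping.keys p. Poly_Mapping.lookup p u * foldr (tensor_act z N) (letters u) f c)"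

lemma act_zero [simp]: "act z N 0 f c = 0"
  by (simp add: act_def)

lemma act_add: "act z N (p + q) f c = act z N p f c + act z N q f c"
  unfolding act_def by (rule setsum_keys_plus_distrib) (simp_all add: distrib_right)

lemma act_uminus: "act z N (- p) f c = - act z N p f c"
  using act_add[of z N p "- p" f c] by (simp add: eq_neg_iff_add_eq_0 add.commute)

lemma act_diff: "act z N (p - q) f c = act z N p f c - act z N q f c"
  using act_add[of z N p "- q" f c] by (simp add: act_uminus)

lemma act_sum: "act z N (sum p A) f c = (\<Sum>a\<in>A. act z N (p a) f c)"
  by (induction A rule: infinite_finite_induct) (auto simp: act_add)

lemma act_single: "act z N (Poly_Mapping.single u a) f c = a * foldr (tensor_act z N) (letters u) f c"
  by (cases "a = 0") (auto simp: act_def)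

lemma act_scalar: "act z N (scalar a) f c = a * f c"
  by (simp add: scalar_def act_single zero_free_monoid_def)

lemma act_one: "act z N 1 f c = f c"
  using act_scalar[of z N 1 f c] by (simp add: scalar_def)

lemma act_gen: "act z N (gen x) f c = tensor_act z N x f c"
  by (simp add: gen_def act_single)

lemma sum_single_lookup: "(\<Sum>u\<in>Poly_Mapping.keys p. Poly_Mapping.single u (Poly_Mapping.lookup p u)) = p"
  by (rule poly_mapping_eqI) (auto simp: lookup_sum lookup_single when_def in_keys_iff sum.delta)

lemma act_mult: "act z N (p * q) f c = act z N p (act z N q f) c"
proof -
  let ?P = "Poly_Mapping.keys p" and ?Q = "Poly_Mapping.keys q"
  let ?p = "Poly_Mapping.lookup p" and ?q = "Poly_Mapping.lookup q"
  have "p * q = (\<Sum>u\<in>?P. \<Sum>v\<in>?Q. Poly_Mapping.single (u + v) (?p u * ?q v))"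
    by (subst (1) sum_single_lookup[symmetric], subst (2) sum_single_lookup[symmetric])
      (simp add: sum_product mult_single)
  then have "act z N (p * q) f c =
      (\<Sum>u\<in>?P. \<Sum>v\<in>?Q. ?p u * ?q v * foldr (tensor_act z N) (letters (u + v)) f c)"
    by (simp add: act_sum act_single)
  also have "\<dots> = (\<Sum>u\<in>?P. ?p u * (\<Sum>v\<in>?Q. ?q v * foldr (tensor_act z N) (letters u) (foldr (tensor_act z N) (letters v) f) c))"
    by (simp add: plus_free_monoid_def sum_distrib_left mult.assoc)
  also have "\<dots> = (\<Sum>u\<in>?P. ?p u * foldr (tensor_act z N) (letters u) (act z N q f) c)"
    unfolding act_def foldr_tensor_act_sum ..
  finally show ?thesis by (simp add: act_def[of z N p])
qed

text \<open>
  The elements that annihilate all tensors form an ideal that contains the defining relations.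
\<close>

lemma act_uea_ideal:
  assumes z: "set z \<subseteq> {1..L}" and p: "p \<in> uea_ideal (lie_power L (gl N))"
  shows "act z N p f c = 0"
proof -
  let ?g = "lie_power L (gl N)" and ?F = "UG.F L N"
  let ?K = "{p \<in> carrier ?F. \<forall>f c. act z N p f c = 0}"
  have "subgroup ?K (add_monoid ?F)"
  proof (rule group.subgroupI)
    show "group (add_monoid ?F)"
      using ring_free_algebra abelian_group.a_group ring.is_abelian_group by blast
    have "0 \<in> ?K" by simp
    then show "?K \<noteq> {}" by blast
    fix a assume a: "a \<in> ?K"
    have "inv\<^bsub>add_monoid ?F\<^esub> a = - a" using a a_inv_free_algebra[of a "carrier ?g"] by (simp add: a_inv_def)
    then show "inv\<^bsub>add_monoid ?F\<^esub> a \<in> ?K" using a by (simp add: act_uminus uminus_carrier)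
  qed (auto simp: act_add)
  moreover have "act z N p (act z N q f) c = 0" if "\<forall>f c. act z N q f c = 0" for p q f c
  proof -
    have "act z N q f = (\<lambda>_. 0)" using that by auto
    moreover have "foldr (tensor_act z N) xs (\<lambda>_. 0) = (\<lambda>_. 0)" for xs
      by (induction xs) (auto simp: tensor_act_def)
    ultimately show ?thesis by (simp add: act_def)
  qed
  ultimately have "ideal ?K ?F"
    by (intro idealI ring_free_algebra) (auto simp: act_mult)
  moreover have "uea_relations ?g \<subseteq> ?K"
  proof
    fix r assume r: "r \<in> uea_relations ?g"
    then have "r \<in> carrier ?F" using UG.uea_relations_carrier by blast
    moreover have "act z N r f c = 0" for f c
    proof -
      have gen: "act z N (gen x) = tensor_act z N x" for x by (intro ext act_gen)
      consider (add) x y where "x \<in> carrier ?g" "y \<in> carrier ?g" "r = gen (x \<oplus>\<^bsub>?g\<^esub> y) - (gen x + gen y)"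
        | (smult) a x where "x \<in> carrier ?g" "r = gen (a \<odot>\<^bsub>?g\<^esub> x) - scalar a * gen x"
        | (bracket) x y where "x \<in> carrier ?g" "y \<in> carrier ?g" "r = gen x * gen y - gen y * gen x - gen (bracket ?g x y)"
        using r unfolding uea_relations_def by blast
      then show ?thesis
      proof cases
        case add
        show ?thesis unfolding add(3) act_diff act_add gen tensor_act_add[OF z add(1,2)] by simp
      next
        case smult
        show ?thesis unfolding smult(2) act_diff act_mult act_scalar gen tensor_act_smult[OF z smult(1)] by simp
      next
        case bracket
        show ?thesis unfolding bracket(3) act_diff act_mult gen tensor_act_bracket[OF z bracket(1,2)] by simp
      qed
    qed
    ultimately show "r \<in> ?K" by simp
  qed
  ultimately have "uea_ideal ?g \<subseteq> ?K"
    unfolding uea_ideal_def by (rule ring.genideal_minimal[OF ring_free_algebra])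
  with p show ?thesis by blast
qed

section \<open>Detecting a pair of words\<close>

lemma act_unit_gen:
  assumes "set z \<subseteq> {1..L}" "i \<in> {1..N}" "a \<in> {1..N}"
  shows "act z N (unit_gen L N i a \<alpha> * q) f c = (\<Sum>t | t < length z \<and> z ! t = \<alpha> \<and> c t = i. act z N q f (c(t := a)))"
proof -
  have "entry N (gl_unit L N i a \<alpha> (z ! t)) r m = of_bool (z ! t = \<alpha> \<and> r = i \<and> m = a)" if "t < length z" for t r m
    using nth_mem[OF that] assms by (auto simp: gl_unit_def entry_mat_unit[OF assms(2,3)] entry_zero)
  then have "act z N (unit_gen L N i a \<alpha> * q) f c
      = (\<Sum>t<length z. \<Sum>m=1..N. if m = a then of_bool (z ! t = \<alpha> \<and> c t = i) * act z N q f (c(t := m)) else 0)"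
    unfolding act_mult unit_gen_def act_gen tensor_act_def by (intro sum.cong refl) auto
  also have "\<dots> = (\<Sum>t<length z. of_bool (z ! t = \<alpha> \<and> c t = i) * act z N q f (c(t := a)))"
    using assms(3) by simp
  also have "\<dots> = (\<Sum>t | t < length z \<and> z ! t = \<alpha> \<and> c t = i. act z N q f (c(t := a)))"
    by (rule sum.mono_neutral_cong_right) auto
  finally show ?thesis .
qed

lemma act_matrix_word_Cons:
  assumes "set z \<subseteq> {1..L}" "i \<in> {1..N}"
  shows "act z N (matrix_word L N i j (\<alpha> # x) * q) f c =
    (\<Sum>a=1..N. \<Sum>t | t < length z \<and> z ! t = \<alpha> \<and> c t = i. act z N (matrix_word L N a j x * q) f (c(t := a)))"
  using assms by (simp add: sum_distrib_right act_sum mult.assoc act_unit_gen)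

definition mismatches :: "nat \<Rightarrow> (nat \<Rightarrow> nat) \<Rightarrow> (nat \<Rightarrow> nat) \<Rightarrow> nat set" where
  "mismatches n c v = {t. t < n \<and> c t \<noteq> v t}"

lemma card_mismatches_upd: "card (mismatches n c v) \<le> Suc (card (mismatches n (c(t := a)) v))"
proof -
  have "mismatches n c v \<subseteq> insert t (mismatches n (c(t := a)) v)" by (auto simp: mismatches_def)
  moreover have "finite (mismatches n (c(t := a)) v)" by (auto simp: mismatches_def)
  ultimately have "card (mismatches n c v) \<le> card (insert t (mismatches n (c(t := a)) v))"
    by (intro card_mono) simp_all
  also have "\<dots> \<le> Suc (card (mismatches n (c(t := a)) v))"
    using \<open>finite _\<close> by (simp add: card_insert_if)
  finally show ?thesis .
qed

definition point_mass :: "nat \<Rightarrow> (nat \<Rightarrow> nat) \<Rightarrow> (nat \<Rightarrow> nat) \<Rightarrow> complex" where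
  "point_mass n v c = of_bool (mismatches n c v = {})"

text \<open>
  Each generator changes at most one position. So if \<open>q\<close> cannot overcome more than \<open>m\<close>
  differences from \<open>v\<close>, a word put in front of it adds at most its length to this bound.
\<close>

lemma act_matrix_word_mult_zero:
  assumes "set z \<subseteq> {1..L}" "i \<in> {1..N}"
    and "\<And>c. card (mismatches (length z) c v) > m \<Longrightarrow> act z N q f c = 0"
    and "card (mismatches (length z) c v) > length x + m"
  shows "act z N (matrix_word L N i j x * q) f c = 0"
  using assms(2,4)
proof (induction x arbitrary: i c)
  case Nil
  then show ?case using assms(3) by simp
next
  case (Cons \<alpha> x)
  have "act z N (matrix_word L N a j x * q) f (c(t := a)) = 0" if "a \<in> {1..N}" for a t
  proof (rule Cons.IH[OF that])
    show "length x + m < card (mismatches (length z) (c(t := a)) v)"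
      using Cons.prems(2) card_mismatches_upd[of "length z" c v t a] by simp
  qed
  then show ?case unfolding act_matrix_word_Cons[OF assms(1) Cons.prems(1)] by simp
qed

lemma act_two_words_zero:
  assumes "set z \<subseteq> {1..L}" "i \<in> {1..N}" "k \<in> {1..N}"
    and "card (mismatches (length z) c v) > length x + length y"
  shows "act z N (matrix_word L N i j x * matrix_word L N k l y) (point_mass (length z) v) c = 0"
proof (rule act_matrix_word_mult_zero[OF assms(1,2) _ assms(4)])
  fix c assume c: "card (mismatches (length z) c v) > length y"
  have "act z N (matrix_word L N k l y * 1) (point_mass (length z) v) c = 0"
    by (rule act_matrix_word_mult_zero[OF assms(1,3), where m = 0 and v = v])
      (use c in \<open>auto simp: act_one point_mass_def\<close>)
  then show "act z N (matrix_word L N k l y) (point_mass (length z) v) c = 0" by simp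
qed

text \<open>
  Let \<open>z\<close> be the concatenation of a word of length \<open>p\<close> and a second word. The numbers from 1 to
  \<open>N = n + 2\<close>, where \<open>n\<close> is the length of \<open>z\<close>, are the vertices of two directed paths: \<open>1, \<dots>, p + 1\<close>
  and \<open>p + 2, \<dots>, n + 2\<close>. Position \<open>t\<close> of the tensor product stands for the \<open>t\<close>-th edge,
  counted from 0. The configuration \<open>start\<close> puts the source of this edge there, and the delta function that serves
  as \<open>f\<close> is supported where every position holds the target. A path without edges is allowed; it
  belongs to an empty word.
\<close>

locale detector =
  fixes L p :: nat and z :: "nat list"
  assumes z: "set z \<subseteq> {1..L}" and p: "p \<le> length z"
begin

abbreviation n where "n \<equiv> length z"
abbreviation N where "N \<equiv> n + 2"

definition start :: "nat \<Rightarrow> nat" where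
  "start t = (if t < p then t + 1 else t + 2)"

text \<open>
  The first \<open>s\<close> edges have been traversed, the others have not.
\<close>

definition hybrid :: "nat \<Rightarrow> nat \<Rightarrow> nat" where
  "hybrid s t = (if t < s then Suc (start t) else start t)"

abbreviation detect where
  "detect q s \<equiv> act z N q (point_mass n (\<lambda>t. Suc (start t))) (hybrid s)"

text \<open>
  Without an edge that leaves the vertex \<open>i\<close> and is yet to be traversed, the first factor is
  wasted, and the remaining factors are too few.
\<close>

lemma detect_Cons_zero:
  assumes "\<And>t. s \<le> t \<Longrightarrow> t < n \<Longrightarrow> start t \<noteq> i" "s \<le> n" "i \<in> {1..N}" "k \<in> {1..N}"
    and "length x + length y < n - s"
  shows "detect (matrix_word L N i j (\<alpha> # x) * matrix_word L N k l y) s = 0"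
proof -
  have "act z N (matrix_word L N a j x * matrix_word L N k l y) (point_mass n (\<lambda>t. Suc (start t))) ((hybrid s)(t := a)) = 0"
    if a: "a \<in> {1..N}" and t: "t < n" "hybrid s t = i" for a t
  proof (rule act_two_words_zero[OF z a assms(4)])
    have "{s..<n} \<subseteq> mismatches n ((hybrid s)(t := a)) (\<lambda>t. Suc (start t))"
      using t assms(1) by (auto simp: mismatches_def hybrid_def split: if_splits)
    from card_mono[OF _ this] have "n - s \<le> card (mismatches n ((hybrid s)(t := a)) (\<lambda>t. Suc (start t)))"
      by (simp add: mismatches_def)
    then show "length x + length y < card (mismatches n ((hybrid s)(t := a)) (\<lambda>t. Suc (start t)))"
      using assms(5) by simp
  qed
  then show ?thesis unfolding act_matrix_word_Cons[OF z assms(3)] by (intro sum.neutral ballI) auto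
qed

lemma start_inject [simp]: "start t = start s \<longleftrightarrow> t = s"
  by (auto simp: start_def)

lemma start_range: "t < n \<Longrightarrow> start t \<in> {1..N} \<and> Suc (start t) \<in> {1..N}"
  by (auto simp: start_def)

text \<open>
  As there are exactly as many factors as edges left, each factor has to traverse one. The only
  such edge that leaves the current vertex is the next one, so the first letter has to be \<open>z ! s\<close>,
  and the summation index has to be the target of that edge.
\<close>

lemma detect_Cons:
  assumes s: "s < n" and k: "k \<in> {1..N}" and len: "Suc (length x + length y) = n - s"
  shows "detect (matrix_word L N (start s) j (\<alpha> # x) * matrix_word L N k l y) s =
    of_bool (z ! s = \<alpha>) * detect (matrix_word L N (Suc (start s)) j x * matrix_word L N k l y) (Suc s)"
proof -
  let ?v = "\<lambda>t. Suc (start t)"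
  let ?T = "{t. t < n \<and> z ! t = \<alpha> \<and> hybrid s t = start s}"
  let ?A = "\<lambda>a t. act z N (matrix_word L N a j x * matrix_word L N k l y) (point_mass n ?v) ((hybrid s)(t := a))"
  have zero: "?A a t = 0" if a: "a \<in> {1..N}" and t: "t \<in> ?T" and ne: "\<not> (t = s \<and> a = ?v s)" for a t
  proof (rule act_two_words_zero[OF z a k])
    have "{s..<n} \<subseteq> mismatches n ((hybrid s)(t := a)) ?v"
      using t ne by (auto simp: mismatches_def hybrid_def split: if_splits)
    from card_mono[OF _ this] have "n - s \<le> card (mismatches n ((hybrid s)(t := a)) ?v)"
      by (simp add: mismatches_def)
    then show "length x + length y < card (mismatches n ((hybrid s)(t := a)) ?v)" using len by simp
  qed
  have upd: "(hybrid s)(s := ?v s) = hybrid (Suc s)"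
    by (auto simp: hybrid_def fun_eq_iff less_Suc_eq)
  have "detect (matrix_word L N (start s) j (\<alpha> # x) * matrix_word L N k l y) s = (\<Sum>a=1..N. \<Sum>t\<in>?T. ?A a t)"
    using start_range[OF s] by (intro act_matrix_word_Cons[OF z]) blast
  also have "\<dots> = (\<Sum>a=1..N. if a = ?v s then \<Sum>t\<in>?T. ?A a t else 0)"
  proof (rule sum.cong[OF refl])
    fix a assume a: "a \<in> {1..N}"
    show "(\<Sum>t\<in>?T. ?A a t) = (if a = ?v s then \<Sum>t\<in>?T. ?A a t else 0)"
    proof (cases "a = ?v s")
      case False
      then have "?A a t = 0" if "t \<in> ?T" for t using zero[OF a that] by blast
      then have "(\<Sum>t\<in>?T. ?A a t) = 0" by (intro sum.neutral ballI)
      then show ?thesis unfolding if_not_P[OF False] .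
    next
      case True
      show ?thesis unfolding if_P[OF True] ..
    qed
  qed
  also have "\<dots> = (\<Sum>t\<in>?T. ?A (?v s) t)"
    using start_range[OF s] by simp
  also have "\<dots> = (\<Sum>t\<in>?T. if t = s then ?A (?v s) s else 0)"
  proof (rule sum.cong[OF refl])
    fix t assume t: "t \<in> ?T"
    show "?A (?v s) t = (if t = s then ?A (?v s) s else 0)"
      using zero[OF conjunct2[OF start_range[OF s]] t] by (cases "t = s") (simp_all only: if_True if_False simp_thms)
  qed
  also have "\<dots> = of_bool (z ! s = \<alpha>) * ?A (?v s) s"
    using s by (auto simp: hybrid_def)
  finally show ?thesis unfolding upd .
qed

lemma detect_second:
  assumes "p \<le> s" "s + length y = n"
  shows "detect (matrix_word L N (s + 2) N y) s = of_bool (y = drop s z)"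
  using assms
proof (induction y arbitrary: s)
  case Nil
  then have "mismatches n (hybrid s) (\<lambda>t. Suc (start t)) = {}"
    by (auto simp: mismatches_def hybrid_def)
  with Nil show ?case by (simp add: act_one point_mass_def)
next
  case (Cons \<alpha> y)
  then have s: "s < n" "start s = s + 2" by (auto simp: start_def)
  \<comment> \<open>A second factor belonging to the empty word is \<open>1\<close>; it gives the product the required shape.\<close>
  have "detect (matrix_word L N (start s) N (\<alpha> # y) * matrix_word L N N N []) s =
    of_bool (z ! s = \<alpha>) * detect (matrix_word L N (Suc (start s)) N y * matrix_word L N N N []) (Suc s)"
    using Cons.prems s by (intro detect_Cons) auto
  then have "detect (matrix_word L N (s + 2) N (\<alpha> # y)) s =
    of_bool (z ! s = \<alpha>) * detect (matrix_word L N (Suc s + 2) N y) (Suc s)"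
    by (simp add: s del: matrix_word.simps(2))
  also have "\<dots> = of_bool (z ! s = \<alpha>) * of_bool (y = drop (Suc s) z)"
    using Cons.IH[of "Suc s"] Cons.prems by simp
  also have "\<dots> = of_bool (\<alpha> # y = drop s z)"
    unfolding Cons_nth_drop_Suc[OF s(1), symmetric] by auto
  finally show ?case .
qed

text \<open>
  The vertex \<open>p + 1\<close> is the end of the first path and no edge leaves it. Hence the first word can
  neither stop early nor continue beyond the path, and the second path is left to the second word.
\<close>

lemma detect_first:
  assumes "s \<le> p" "s + (length x + length y) = n"
  shows "detect (matrix_word L N (s + 1) (p + 1) x * matrix_word L N (p + 2) N y) s =
    of_bool (x = take (p - s) (drop s z) \<and> y = drop p z)"
  using assms
proof (induction x arbitrary: s)
  case Nil
  then show ?case using detect_second[of p y] p by (cases "s = p") auto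
next
  case (Cons \<alpha> x)
  show ?case
  proof (cases "s = p")
    case True
    have "detect (matrix_word L N (s + 1) (p + 1) (\<alpha> # x) * matrix_word L N (p + 2) N y) s = 0"
      using Cons.prems p True by (intro detect_Cons_zero) (auto simp: start_def)
    with True show ?thesis by simp
  next
    case False
    then have s: "s < n" "s < p" "start s = s + 1" using Cons.prems p by (auto simp: start_def)
    have "detect (matrix_word L N (start s) (p + 1) (\<alpha> # x) * matrix_word L N (p + 2) N y) s =
      of_bool (z ! s = \<alpha>) * detect (matrix_word L N (Suc (start s)) (p + 1) x * matrix_word L N (p + 2) N y) (Suc s)"
      using Cons.prems s p by (intro detect_Cons) auto
    then have "detect (matrix_word L N (s + 1) (p + 1) (\<alpha> # x) * matrix_word L N (p + 2) N y) s =
      of_bool (z ! s = \<alpha>) * detect (matrix_word L N (Suc s + 1) (p + 1) x * matrix_word L N (p + 2) N y) (Suc s)"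
      by (simp add: s(3) del: matrix_word.simps(2))
    also have "\<dots> = of_bool (z ! s = \<alpha>) * of_bool (x = take (p - Suc s) (drop (Suc s) z) \<and> y = drop p z)"
      using Cons.IH[of "Suc s"] Cons.prems s by simp
    also have "\<dots> = of_bool (\<alpha> # x = take (p - s) (drop s z) \<and> y = drop p z)"
    proof -
      have "p - s = Suc (p - Suc s)" using s(2) by simp
      then have "take (p - s) (drop s z) = z ! s # take (p - Suc s) (drop (Suc s) z)"
        unfolding Cons_nth_drop_Suc[OF s(1), symmetric] by (simp only: take_Suc_Cons)
      then show ?thesis by auto
    qed
    finally show ?thesis .
  qed
qed

lemma detect_start:
  assumes "i \<in> {1..N}" "k \<in> {1..N}" "length x + length y < n"
  shows "detect (matrix_word L N i j x * matrix_word L N k l y) 0 = 0"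
proof (rule act_two_words_zero[OF z assms(1,2)])
  have "mismatches n (hybrid 0) (\<lambda>t. Suc (start t)) = {..<n}"
    by (auto simp: mismatches_def hybrid_def)
  then show "length x + length y < card (mismatches n (hybrid 0) (\<lambda>t. Suc (start t)))" using assms(3) by simp
qed

end

section \<open>Uniqueness of the coefficients\<close>

lemma act_of_int_mult: "act z N (of_int e * q) f c = of_int e * act z N q f c"
proof -
  have "of_int e * q = scalar (of_int e) * q" by (simp add: scalar_def)
  then show ?thesis by (simp only: act_mult act_scalar)
qed

lemma basis_product_two_words:
  assumes "i \<in> {1..N}" "j \<in> {1..N}" "k \<in> {1..N}" "l \<in> {1..N}"
  obtains i' j' k' l' where "i' \<in> {1..N}" "k' \<in> {1..N}"
    "basis_product L N be bo par x i j k l = matrix_word L N i' j' (fst x) * matrix_word L N k' l' (snd x)"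
  using assms unfolding basis_product_def ordered_product_def by metis

text \<open>
  In each of the forms, suitable values of \<open>i, j, k, l\<close> bring prescribed indices to the four
  places of the product. They depend only on the parity of the length, so they fit all terms of the
  same length simultaneously.
\<close>

lemma basis_product_relabel:
  fixes a b c d N :: nat
  assumes "a \<in> {1..N}" "b \<in> {1..N}" "c \<in> {1..N}" "d \<in> {1..N}"
  obtains i j k l where "i \<in> {1..N}" "j \<in> {1..N}" "k \<in> {1..N}" "l \<in> {1..N}"
    "\<And>x. even (pair_length x) = e \<Longrightarrow>
      basis_product L N be bo par x i j k l = matrix_word L N a b (fst x) * matrix_word L N c d (snd x)"
proof -
  consider "e = par" be | "e = par" "\<not> be" | "e \<noteq> par" bo | "e \<noteq> par" "\<not> bo" by blast
  then show thesis
  proof cases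
    case 1
    then show thesis using assms by (intro that[of a b c d]) (auto simp: basis_product_def ordered_product_def)
  next
    case 2
    then show thesis using assms by (intro that[of c d a b]) (auto simp: basis_product_def ordered_product_def)
  next
    case 3
    then show thesis using assms by (intro that[of a d c b]) (auto simp: basis_product_def ordered_product_def)
  next
    case 4
    then show thesis using assms by (intro that[of c b a d]) (auto simp: basis_product_def ordered_product_def)
  qed
qed

text \<open>
  A pair of maximal length among those with a nonzero coefficient is detected by an
  action that annihilates the terms of all other such pairs.
\<close>

lemma expansion_zero_imp_coeffs_zero:
  assumes zero: "\<And>N i j k l. i \<in> {1..N} \<Longrightarrow> j \<in> {1..N} \<Longrightarrow> k \<in> {1..N} \<Longrightarrow> l \<in> {1..N} \<Longrightarrow>
      UG.cong L N (expansion L N be bo par n e i j k l) 0"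
    and x: "x \<in> word_pairs L n"
  shows "e x = 0"
proof (rule ccontr)
  assume "e x \<noteq> 0"
  define S where "S = {x \<in> word_pairs L n. e x \<noteq> 0}"
  have "finite S" "x \<in> S" using x \<open>e x \<noteq> 0\<close> by (simp_all add: S_def)
  then have "Max (pair_length ` S) \<in> pair_length ` S" by (intro Max_in) auto
  then obtain y where "y \<in> S" "pair_length y = Max (pair_length ` S)" by auto
  with \<open>finite S\<close> have y: "y \<in> S" "\<And>x. x \<in> S \<Longrightarrow> pair_length x \<le> pair_length y" by simp_all
  define z where "z = fst y @ snd y"
  interpret detector L "length (fst y)" z
    using y(1) by unfold_locales (auto simp: z_def S_def word_pairs_def)
  let ?m = "pair_length y"
  have len: "length z = ?m" by (simp add: z_def pair_length_def)
  have range: "1 \<in> {1..?m + 2}" "length (fst y) + 1 \<in> {1..?m + 2}"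
    "length (fst y) + 2 \<in> {1..?m + 2}" "?m + 2 \<in> {1..?m + 2}"
    by (auto simp: pair_length_def)
  obtain i j k l where ijkl: "i \<in> {1..?m + 2}" "j \<in> {1..?m + 2}" "k \<in> {1..?m + 2}" "l \<in> {1..?m + 2}"
    and basis: "\<And>x. even (pair_length x) = even ?m \<Longrightarrow>
      basis_product L (?m + 2) be bo par x i j k l =
      matrix_word L (?m + 2) 1 (length (fst y) + 1) (fst x) * matrix_word L (?m + 2) (length (fst y) + 2) (?m + 2) (snd x)"
    using basis_product_relabel[OF range, of "even ?m" L be bo par] by blast
  let ?act = "\<lambda>q. act z (?m + 2) q (point_mass ?m (\<lambda>t. Suc (start t))) (hybrid 0)"
  have detects: "of_int (e x) * ?act (basis_product L (?m + 2) be bo par x i j k l) = (if x = y then of_int (e y) else 0)"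
    if x: "x \<in> word_pairs L n" for x
  proof (cases "x \<in> S")
    case False
    then show ?thesis using x y(1) by (auto simp: S_def)
  next
    case True
    then consider "pair_length x < ?m" | "pair_length x = ?m" using y(2) le_neq_implies_less by blast
    then show ?thesis
    proof cases
      case 1
      obtain i' j' k' l' where "i' \<in> {1..?m + 2}" "k' \<in> {1..?m + 2}"
        and eq: "basis_product L (?m + 2) be bo par x i j k l = matrix_word L (?m + 2) i' j' (fst x) * matrix_word L (?m + 2) k' l' (snd x)"
        using ijkl by (rule basis_product_two_words)
      then have "?act (basis_product L (?m + 2) be bo par x i j k l) = 0"
        using 1 detect_start[of i' k' "fst x" "snd x" j' l'] by (simp add: len pair_length_def[of x])
      then show ?thesis using 1 by auto
    next
      case 2
      have "?act (basis_product L (?m + 2) be bo par x i j k l) = of_bool (fst x = take (length (fst y)) z \<and> snd x = drop (length (fst y)) z)"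
        using detect_first[of 0 "fst x" "snd x"] 2 basis[of x] by (simp add: len pair_length_def[of x])
      also have "(fst x = take (length (fst y)) z \<and> snd x = drop (length (fst y)) z) \<longleftrightarrow> x = y"
        by (simp add: z_def prod_eq_iff)
      finally show ?thesis by simp
    qed
  qed
  have "?act (expansion L (?m + 2) be bo par n e i j k l) =
      (\<Sum>x\<in>word_pairs L n. of_int (e x) * ?act (basis_product L (?m + 2) be bo par x i j k l))"
    by (simp only: expansion_def act_sum act_of_int_mult)
  also have "\<dots> = (\<Sum>x\<in>word_pairs L n. if x = y then of_int (e y) else 0)"
    by (rule sum.cong[OF refl detects])
  also have "\<dots> = of_int (e y)" using y(1) by (simp add: S_def)
  finally have "?act (expansion L (?m + 2) be bo par n e i j k l) = of_int (e y)" .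
  moreover have "?act (expansion L (?m + 2) be bo par n e i j k l) = 0"
    using act_uea_ideal[OF z] zero[OF ijkl] by (simp add: UG.cong_def)
  ultimately show False using y(1) by (simp add: S_def)
qed

lemma expansion_coeffs_unique:
  assumes "\<And>N i j k l. i \<in> {1..N} \<Longrightarrow> j \<in> {1..N} \<Longrightarrow> k \<in> {1..N} \<Longrightarrow> l \<in> {1..N} \<Longrightarrow>
      UG.cong L N (expansion L N be bo par n c i j k l) (expansion L N be bo par n d i j k l)"
    and x: "x \<in> word_pairs L n"
  shows "c x = d x"
proof -
  have "UG.cong L N (expansion L N be bo par n (\<lambda>z. c z - d z) i j k l) 0"
    if "i \<in> {1..N}" "j \<in> {1..N}" "k \<in> {1..N}" "l \<in> {1..N}" for N i j k l
    using assms(1)[OF that] by (simp only: expansion_diff UG.cong_def diff_zero)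
  from expansion_zero_imp_coeffs_zero[OF this x] show ?thesis by simp
qed

section \<open>The expansions of the commutator\<close>

lemma ordered_product_carrier: "ordered_product L N b z i j k l \<in> carrier (UG.F L N)"
  by (cases b) (simp_all add: ordered_product_def mult_carrier)

lemma expansion_carrier: "expansion L N be bo par n c i j k l \<in> carrier (UG.F L N)"
  unfolding expansion_def
  by (intro sum_carrier mult_carrier of_int_carrier) (simp add: basis_product_def ordered_product_carrier)

lemma Odd_Even_word_pairs:
  fixes w w' :: "nat list"
  defines "m \<equiv> length w + length w'"
  shows "Odd L w w' = {z \<in> word_pairs L (m - 1). even (pair_length z) \<noteq> even m}"
    and "Even L w w' = {z \<in> word_pairs L (m - 1). even (pair_length z) = even m}"
proof -
  have letters: "x \<in> words L \<union> {[]} \<longleftrightarrow> set x \<subseteq> {1..L}" for x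
    by (auto simp: words_def)
  have parity: "k < m \<Longrightarrow> even (m - k) \<longleftrightarrow> even k = even m" for k
    by (metis even_diff_nat less_imp_le_nat nat_less_le not_less even_add)
  have member: "(x, y) \<in> word_pairs L (m - 1) \<longleftrightarrow> x \<in> words L \<union> {[]} \<and> y \<in> words L \<union> {[]}
      \<and> \<not> (x = [] \<and> y = []) \<and> length x + length y < m" for x y
    unfolding letters word_pairs_def length_0_conv[symmetric] mem_Collect_eq prod.case by linarith
  show "Odd L w w' = {z \<in> word_pairs L (m - 1). even (pair_length z) \<noteq> even m}"
  proof (rule Set.set_eqI)
    fix z :: "nat list \<times> nat list"
    obtain x y where z: "z = (x, y)" by (cases z)
    show "z \<in> Odd L w w' \<longleftrightarrow> z \<in> {z \<in> word_pairs L (m - 1). even (pair_length z) \<noteq> even m}"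
      unfolding z mem_Collect_eq member Odd_def prod.case m_def[symmetric] pair_length_def fst_conv snd_conv
      using parity[of "length x + length y"] by blast
  qed
  show "Even L w w' = {z \<in> word_pairs L (m - 1). even (pair_length z) = even m}"
  proof (rule Set.set_eqI)
    fix z :: "nat list \<times> nat list"
    obtain x y where z: "z = (x, y)" by (cases z)
    show "z \<in> Even L w w' \<longleftrightarrow> z \<in> {z \<in> word_pairs L (m - 1). even (pair_length z) = even m}"
      unfolding z mem_Collect_eq member Even_def prod.case m_def[symmetric] pair_length_def fst_conv snd_conv
      using parity[of "length x + length y"] by blast
  qed
qed

text \<open>
  Terms of odd and of even length difference are indexed by disjoint sets, so the two families of
  coefficients can be glued into one.
\<close>

definition combine :: "nat \<Rightarrow> (nat list \<times> nat list \<Rightarrow> int) \<Rightarrow> (nat list \<times> nat list \<Rightarrow> int) \<Rightarrow> nat list \<times> nat list \<Rightarrow> int" where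
  "combine m \<phi> \<psi> z = (if even (pair_length z) = even m then \<psi> z else \<phi> z)"

lemma coeff_sum_ordered:
  assumes "j \<in> {1..N}" "l \<in> {1..N}"
  shows "(if b then coeff_sum L N S c i j k l else coeff_sum L N S c k l i j) =
    UG.cls L N (\<Sum>z\<in>S. of_int (c z) * ordered_product L N b z i j k l)"
  by (cases b) (simp_all only: if_True if_False ordered_product_def coeff_sum_eq_cls[OF assms] coeff_sum_eq_cls[OF assms(2,1)])

lemma coeff_sums_eq_expansion:
  fixes w w' :: "nat list"
  defines "m \<equiv> length w + length w'"
  assumes "i \<in> {1..N}" "j \<in> {1..N}" "k \<in> {1..N}" "l \<in> {1..N}"
  shows "(if bo then coeff_sum L N (Odd L w w') \<phi> i l k j else coeff_sum L N (Odd L w w') \<phi> k j i l)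
      \<oplus>\<^bsub>U_gl L N\<^esub> (if be then coeff_sum L N (Even L w w') \<psi> i j k l else coeff_sum L N (Even L w w') \<psi> k l i j)
    = UG.cls L N (expansion L N be bo (even m) (m - 1) (combine m \<phi> \<psi>) i j k l)"
proof -
  let ?o = "\<Sum>z\<in>Odd L w w'. of_int (\<phi> z) * ordered_product L N bo z i l k j"
  let ?e = "\<Sum>z\<in>Even L w w'. of_int (\<psi> z) * ordered_product L N be z i j k l"
  let ?t = "\<lambda>z. of_int (combine m \<phi> \<psi> z) * basis_product L N be bo (even m) z i j k l"
  note OE = Odd_Even_word_pairs[of L w w', folded m_def]
  have un: "word_pairs L (m - 1) = Odd L w w' \<union> Even L w w'" and disj: "Odd L w w' \<inter> Even L w w' = {}"
    unfolding OE by auto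
  have fin: "finite (Odd L w w')" "finite (Even L w w')"
    using finite_word_pairs[of L "m - 1"] unfolding un by simp_all
  have "expansion L N be bo (even m) (m - 1) (combine m \<phi> \<psi>) i j k l = sum ?t (Odd L w w') + sum ?t (Even L w w')"
    unfolding expansion_def un by (rule sum.union_disjoint[OF fin disj])
  also have "sum ?t (Odd L w w') = ?o"
    by (rule sum.cong) (simp_all add: OE combine_def basis_product_def)
  also have "sum ?t (Even L w w') = ?e"
    by (rule sum.cong) (simp_all add: OE combine_def basis_product_def)
  finally have exp: "expansion L N be bo (even m) (m - 1) (combine m \<phi> \<psi>) i j k l = ?o + ?e" .
  have carr: "?o \<in> carrier (UG.F L N)" "?e \<in> carrier (UG.F L N)"
    by (intro sum_carrier mult_carrier of_int_carrier ordered_product_carrier)+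
  show ?thesis
    unfolding exp coeff_sum_ordered[OF assms(5,3)] coeff_sum_ordered[OF assms(3,5)] U_gl_def
    by (rule UG.cls_add[OF carr])
qed

text \<open>
  The even-difference terms have the factor \<open>e\<^sub>i\<^sub>j\<close> in front for \<open>r = 1, 3\<close>, and the odd-difference
  terms have the factor \<open>e\<^sub>i\<^sub>l\<close> in front for \<open>r = 3, 4\<close>; these are the values of the two order flags.
\<close>

lemma expands_commutators_iff:
  fixes w w' :: "nat list"
  defines "m \<equiv> length w + length w'"
  shows "expands_commutators L w w' \<phi> \<psi> \<longleftrightarrow> (\<forall>r\<in>{1..4}. \<forall>N. \<forall>i\<in>{1..N}. \<forall>j\<in>{1..N}. \<forall>k\<in>{1..N}. \<forall>l\<in>{1..N}.
    UG.cong L N (matrix_word L N i j w * matrix_word L N k l w' - matrix_word L N k l w' * matrix_word L N i j w)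
      (expansion L N (odd r) (3 \<le> r) (even m) (m - 1) (combine m (\<phi> r) (\<psi> r)) i j k l))"
proof -
  have four: "(\<forall>r\<in>{1..4}. P r) \<longleftrightarrow> P 1 \<and> P 2 \<and> P 3 \<and> P (4::nat)" for P
  proof -
    have "{1..4} = {1, 2, 3, 4::nat}" by auto
    then show ?thesis by simp
  qed
  have comm: "commutator (U_gl L N) (e_word L N i j w) (e_word L N k l w') =
      UG.cls L N (matrix_word L N i j w * matrix_word L N k l w' - matrix_word L N k l w' * matrix_word L N i j w)"
    if "j \<in> {1..N}" "l \<in> {1..N}" for N i j k l
    using that by (simp add: commutator_def e_word_eq_cls U_gl_def UG.cls_mult UG.cls_minus mult_carrier)
  have eq: "commutator (U_gl L N) (e_word L N i j w) (e_word L N k l w') =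
      (if 3 \<le> r then coeff_sum L N (Odd L w w') (\<phi> r) i l k j else coeff_sum L N (Odd L w w') (\<phi> r) k j i l)
      \<oplus>\<^bsub>U_gl L N\<^esub> (if odd r then coeff_sum L N (Even L w w') (\<psi> r) i j k l else coeff_sum L N (Even L w w') (\<psi> r) k l i j)
    \<longleftrightarrow> UG.cong L N (matrix_word L N i j w * matrix_word L N k l w' - matrix_word L N k l w' * matrix_word L N i j w)
      (expansion L N (odd r) (3 \<le> r) (even m) (m - 1) (combine m (\<phi> r) (\<psi> r)) i j k l)"
    if "i \<in> {1..N}" "j \<in> {1..N}" "k \<in> {1..N}" "l \<in> {1..N}" for N i j k l and r :: nat
    unfolding coeff_sums_eq_expansion[OF that, folded m_def] comm[OF that(2,4)] m_def[symmetric]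
    by (intro UG.cls_eq_iff_cong expansion_carrier minus_carrier mult_carrier matrix_word_carrier)
  define Q where "Q r N i j k l \<longleftrightarrow>
    UG.cong L N (matrix_word L N i j w * matrix_word L N k l w' - matrix_word L N k l w' * matrix_word L N i j w)
      (expansion L N (odd r) (3 \<le> r) (even m) (m - 1) (combine m (\<phi> r) (\<psi> r)) i j k l)" for r N i j k l
  note eq = eq[folded Q_def]
  have "expands_commutators L w w' \<phi> \<psi> \<longleftrightarrow> (\<forall>i j k l N. i \<in> {1..N} \<and> j \<in> {1..N} \<and> k \<in> {1..N} \<and> l \<in> {1..N} \<longrightarrow>
      Q 1 N i j k l \<and> Q 2 N i j k l \<and> Q 3 N i j k l \<and> Q 4 N i j k l)"
    unfolding expands_commutators_def Let_def
  proof (intro iff_allI imp_cong)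
    fix i j k l N :: nat
    show "(1 \<le> i \<and> 1 \<le> j \<and> 1 \<le> k \<and> 1 \<le> l \<and> i \<le> N \<and> j \<le> N \<and> k \<le> N \<and> l \<le> N) =
      (i \<in> {1..N} \<and> j \<in> {1..N} \<and> k \<in> {1..N} \<and> l \<in> {1..N})" by auto
    assume "i \<in> {1..N} \<and> j \<in> {1..N} \<and> k \<in> {1..N} \<and> l \<in> {1..N}"
    then have "i \<in> {1..N}" "j \<in> {1..N}" "k \<in> {1..N}" "l \<in> {1..N}" by blast+
    from eq[OF this] have eq: "commutator (U_gl L N) (e_word L N i j w) (e_word L N k l w') =
      (if 3 \<le> r then coeff_sum L N (Odd L w w') (\<phi> r) i l k j else coeff_sum L N (Odd L w w') (\<phi> r) k j i l)
      \<oplus>\<^bsub>U_gl L N\<^esub> (if odd r then coeff_sum L N (Even L w w') (\<psi> r) i j k l else coeff_sum L N (Even L w w') (\<psi> r) k l i j)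
      \<longleftrightarrow> Q r N i j k l" for r .
    show "(commutator (U_gl L N) (e_word L N i j w) (e_word L N k l w') =
        coeff_sum L N (Odd L w w') (\<phi> 1) k j i l \<oplus>\<^bsub>U_gl L N\<^esub> coeff_sum L N (Even L w w') (\<psi> 1) i j k l \<and>
        commutator (U_gl L N) (e_word L N i j w) (e_word L N k l w') =
        coeff_sum L N (Odd L w w') (\<phi> 2) k j i l \<oplus>\<^bsub>U_gl L N\<^esub> coeff_sum L N (Even L w w') (\<psi> 2) k l i j \<and>
        commutator (U_gl L N) (e_word L N i j w) (e_word L N k l w') =
        coeff_sum L N (Odd L w w') (\<phi> 3) i l k j \<oplus>\<^bsub>U_gl L N\<^esub> coeff_sum L N (Even L w w') (\<psi> 3) i j k l \<and>
        commutator (U_gl L N) (e_word L N i j w) (e_word L N k l w') =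
        coeff_sum L N (Odd L w w') (\<phi> 4) i l k j \<oplus>\<^bsub>U_gl L N\<^esub> coeff_sum L N (Even L w w') (\<psi> 4) k l i j) =
      (Q 1 N i j k l \<and> Q 2 N i j k l \<and> Q 3 N i j k l \<and> Q 4 N i j k l)"
      using eq[of 1] eq[of 2] eq[of 3] eq[of 4] by simp
  qed
  also have "\<dots> \<longleftrightarrow> (\<forall>r\<in>{1..4}. \<forall>N. \<forall>i\<in>{1..N}. \<forall>j\<in>{1..N}. \<forall>k\<in>{1..N}. \<forall>l\<in>{1..N}. Q r N i j k l)"
  proof -
    have "(\<forall>i j k l N. i \<in> {1..N} \<and> j \<in> {1..N} \<and> k \<in> {1..N} \<and> l \<in> {1..N} \<longrightarrow> Q r N i j k l)
      \<longleftrightarrow> (\<forall>N. \<forall>i\<in>{1..N}. \<forall>j\<in>{1..N}. \<forall>k\<in>{1..N}. \<forall>l\<in>{1..N}. Q r N i j k l)" for r by blast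
    then show ?thesis unfolding four imp_conjR all_conj_distrib by (simp only:)
  qed
  finally show ?thesis unfolding Q_def .
qed

theorem lemma7p1:
  fixes L :: nat and w w' :: "nat list"
  assumes "2 \<le> L" and "w \<in> words L" and "w' \<in> words L"
  shows "\<exists>\<phi> \<psi> :: nat \<Rightarrow> nat list \<times> nat list \<Rightarrow> int.
    expands_commutators L w w' \<phi> \<psi> \<and>
    (\<forall>\<phi>' \<psi>'. expands_commutators L w w' \<phi>' \<psi>' \<longrightarrow>
      (\<forall>r\<in>{1..4}. (\<forall>z\<in>Odd L w w'. \<phi>' r z = \<phi> r z) \<and> (\<forall>z\<in>Even L w w'. \<psi>' r z = \<psi> r z)))"
proof -
  let ?m = "length w + length w'"
  have w: "set w \<subseteq> {1..L}" "set w' \<subseteq> {1..L}" using assms by (auto simp: words_def)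
  define comm where "comm N i j k l =
    matrix_word L N i j w * matrix_word L N k l w' - matrix_word L N k l w' * matrix_word L N i j w" for N i j k l
  define valid where "valid r c \<longleftrightarrow> (\<forall>N. \<forall>i\<in>{1..N}. \<forall>j\<in>{1..N}. \<forall>k\<in>{1..N}. \<forall>l\<in>{1..N}.
    UG.cong L N (comm N i j k l) (expansion L N (odd r) (3 \<le> r) (even ?m) (?m - 1) c i j k l))" for r :: nat and c
  have iff: "expands_commutators L w w' \<phi> \<psi> \<longleftrightarrow> (\<forall>r\<in>{1..4}. valid r (combine ?m (\<phi> r) (\<psi> r)))" for \<phi> \<psi>
    unfolding expands_commutators_iff valid_def comm_def ..
  have "\<exists>c. valid r c" for r
    using expandable_commutator[OF w, of "odd r" "3 \<le> r"] unfolding expandable_def valid_def comm_def .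
  then have c: "valid r (SOME c. valid r c)" for r by (rule someI_ex)
  define c where "c r = (SOME c. valid r c)" for r
  \<comment> \<open>One function can provide both families, since they are used on disjoint sets of pairs.\<close>
  have "combine ?m (c r) (c r) = c r" for r by (simp add: combine_def fun_eq_iff)
  with c have ex: "expands_commutators L w w' c c"
    unfolding iff c_def by simp
  have unique: "(\<forall>z\<in>Odd L w w'. \<phi> r z = c r z) \<and> (\<forall>z\<in>Even L w w'. \<psi> r z = c r z)"
    if exp: "expands_commutators L w w' \<phi> \<psi>" and r: "r \<in> {1..4}" for \<phi> \<psi> and r :: nat
  proof -
    have eqc: "combine ?m (\<phi> r) (\<psi> r) z = c r z" if z: "z \<in> word_pairs L (?m - 1)" for z
    proof (rule expansion_coeffs_unique[OF _ z])
      fix N i j k l :: nat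
      assume "i \<in> {1..N}" "j \<in> {1..N}" "k \<in> {1..N}" "l \<in> {1..N}"
      moreover have "valid r (combine ?m (\<phi> r) (\<psi> r))" "valid r (c r)"
        using exp r c unfolding iff c_def by blast+
      ultimately have
        "UG.cong L N (comm N i j k l) (expansion L N (odd r) (3 \<le> r) (even ?m) (?m - 1) (combine ?m (\<phi> r) (\<psi> r)) i j k l)"
        "UG.cong L N (comm N i j k l) (expansion L N (odd r) (3 \<le> r) (even ?m) (?m - 1) (c r) i j k l)"
        unfolding valid_def by blast+
      from UG.cong_trans[OF UG.cong_sym[OF this(1)] this(2)]
      show "UG.cong L N (expansion L N (odd r) (3 \<le> r) (even ?m) (?m - 1) (combine ?m (\<phi> r) (\<psi> r)) i j k l)
        (expansion L N (odd r) (3 \<le> r) (even ?m) (?m - 1) (c r) i j k l)" .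
    qed
    have "\<phi> r z = c r z" if "z \<in> word_pairs L (?m - 1)" "even (pair_length z) \<noteq> even ?m" for z
      using that eqc[OF that(1)] unfolding combine_def by metis
    moreover have "\<psi> r z = c r z" if "z \<in> word_pairs L (?m - 1)" "even (pair_length z) = even ?m" for z
      using that eqc[OF that(1)] unfolding combine_def by metis
    ultimately show ?thesis unfolding Odd_Even_word_pairs by blast
  qed
  from ex unique show ?thesis by blast
qed

end
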